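(* Let $q=2^m$ with $m\ge 19$, and let $A,B\in\mathbb{F}_{q^3}\setminus\{0\}$. Then the polynomial $f_{A,B}(X)=X^{q^2-q+1}+AX^{q^2}+BX\in\mathbb{F}_{q^3}[X]$ is a permutation polynomial of $\mathbb{F}_{q^3}$ if and only if one of the following conditions holds: (1) $A^{1+q+q^2}=B^{1+q+q^2}$ and $A^qB\in\mathbb{F}_q\setminus\{0,1\}$; (2) $A^qB=1$ and $B^{1+q+q^2}\neq 1$.
   Context: $\mathbb{F}_{q}\subset\mathbb{F}_{q^3}$ denote the finite fields with $q$ and $q^3$ elements. A polynomial in $\mathbb{F}_{q^3}[X]$ is a permutation polynomial (PP) of $\mathbb{F}_{q^3}$ if the map $x\mapsto f(x)$ is a bijection of $\mathbb{F}_{q^3}$ onto itself. *)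

theory Defs
  imports
    "HOL-Library.Cardinality"
    "HOL-Computational_Algebra.Polynomial"
    "HOL-Computational_Algebra.Primes"
begin

definition is_subfield :: "'a::field set \<Rightarrow> bool" where
  "is_subfield K \<longleftrightarrow>
     0 \<in> K \<and> 1 \<in> K \<and>
     (\<forall>x\<in>K. \<forall>y\<in>K. x + y \<in> K) \<and> (\<forall>x\<in>K. - x \<in> K) \<and>
     (\<forall>x\<in>K. \<forall>y\<in>K. x * y \<in> K) \<and> (\<forall>x\<in>K. inverse x \<in> K)"

definition permutation_polynomial :: "'a::finite_field poly \<Rightarrow> bool" where
  "permutation_polynomial f \<longleftrightarrow> bij (poly f)"

(* The exponent q^2 - q + 1 is never affected by truncated subtraction, as q \<le> q^2 on nat. *)
definition f_poly :: "nat \<Rightarrow> 'a::comm_ring_1 \<Rightarrow> 'a \<Rightarrow> 'a poly" where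
  "f_poly q A B = monom 1 (q^2 - q + 1) + monom A (q^2) + monom B 1"

end

theory Submission
  imports Defs "HOL-Library.FuncSet"
begin

text \<open>Substituting \<open>u = 1 / x\<close> turns \<open>f\<close>, up to the norm of \<open>u\<close>, into the quadratic map
  \<open>g u = u ^ q * (A * u + u ^ q + B * u ^ q\<^sup>2)\<close>, and \<open>f\<close> permutes the field iff \<open>g\<close> is injective.
  If \<open>A\<close> and \<open>B\<close> have equal norms, Hilbert 90 allows \<open>A = B\<close>, where \<open>g\<close> involves only the trace.
  Otherwise the collisions of \<open>g\<close> are the zeros of a ternary cubic form over \<open>Fq\<close>, so \<open>g\<close> is injective
  iff this cubic has no rational point.

  A cubic form \<open>T\<close> in characteristic two with nonzero coefficient of \<open>xyz\<close> and without rational points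
  is a norm form. Indeed, the fourth moment over all cubics of the deviation of the number of points,
  computable because cubics separate four points, leaves room for at most \<open>4 q ^ 8\<close> cubics without points,
  whereas the orbit of \<open>T\<close> under the linear group has about \<open>q ^ 9\<close> elements unless \<open>T\<close> has many symmetries.
  If \<open>T\<close> is not a norm form, each symmetry that is not a scalar has trace zero, so symmetries that are pairwise
  not proportional are orthonormal for the trace form and there are at most nine of them.
  Comparing coefficients with a norm form gives \<open>A ^ q * B = 1\<close>.\<close>

section \<open>The cubic extension in characteristic two\<close>

text \<open>The second moment would not do: a form without points deviates by
  \<open>n = q^2 + q + 1\<close>, and a bound \<open>N * n^2 \<le> n * q * q^10\<close> leaves room
  for about \<open>q^9\<close> such forms, the size of the linear group itself. The fourth moment
  gains a factor \<open>q\<close>, and it is the highest that separation covers, as a product of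
  three linear forms tells one point from three others. What remains to be beaten by
  \<open>q\<close> is \<open>27 * 4 + 2 = 110\<close>. Norm forms escape because multiplication by
  elements of norm one supplies about \<open>q^2\<close> symmetries.

  Characteristic two acts through full polarization: monomials with a square drop out, and
  \<open>h\<close> times a determinant remains. Hence \<open>h \<noteq> 0\<close> forces symmetries
  to have determinant one. The collision cubic has \<open>h = nm A + nm B\<close>, which is why
  equal norms are treated apart.

  No coordinates over \<open>Fq\<close> are chosen: the big field is the three-dimensional space,
  linear maps are linearized polynomials, functionals are traces, and a cubic form is a trace of
  monomials in \<open>x\<close> and its conjugates plus a multiple of the norm.\<close>

locale cubic_extension =
  fixes m q :: nat and Fq :: "'a::finite_field set"
  assumes m_ge: "m \<ge> 19"
    and q_eq: "q = 2 ^ m"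
    and card_UNIV_eq: "CARD('a) = q ^ 3"
    and subfield_Fq: "is_subfield Fq"
    and card_Fq: "card Fq = q"
begin

lemma q_ge: "q \<ge> 2 ^ 19"
  unfolding q_eq using m_ge by (intro power_increasing) auto

text \<open>Translation by one permutes the field, so summing all elements shows that the
  cardinality, a power of two, vanishes in it.\<close>

lemma char_eq_2: "CHAR('a) = 2"
proof -
  have "(\<Sum>y\<in>UNIV. y + (1::'a)) = (\<Sum>y\<in>UNIV. y)"
    by (rule sum.reindex_bij_witness[of _ "\<lambda>y. y - 1" "\<lambda>y. y + 1"]) auto
  hence "of_nat CARD('a) = (0::'a)" by (simp add: sum.distrib)
  hence "CHAR('a) dvd CARD('a)" by (simp only: of_nat_eq_0_iff_char_dvd)
  hence "CHAR('a) dvd 2 ^ (m * 3)" unfolding card_UNIV_eq q_eq by (simp add: power_mult)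
  hence "CHAR('a) dvd 2" using prime_dvd_power CHAR_prime by blast
  thus ?thesis using primes_dvd_imp_eq two_is_prime_nat CHAR_prime by blast
qed

lemma two_eq_0 [simp]: "(2::'a) = 0"
  using of_nat_CHAR[where 'a='a] char_eq_2 by simp

lemma add_self [simp]: "x + x = (0::'a)"
  by (metis mult_2 mult_zero_left two_eq_0)

lemma add_self_left [simp]: "x + (x + y) = (y::'a)"
  by (simp add: add.assoc[symmetric])

lemma uminus_char2 [simp]: "- x = (x::'a)"
  by (metis add_self add_eq_0_iff)

lemma diff_char2 [simp]: "x - y = x + (y::'a)"
  by (metis diff_conv_add_uminus uminus_char2)

lemma add_eq_0_char2: "x + y = 0 \<longleftrightarrow> x = (y::'a)"
  by (metis add_self add_eq_0_iff uminus_char2)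

lemma numeral_3 [simp]: "(3::'a) = 1"
proof -
  have "(3::'a) = 2 + 1" by (simp only: numeral_plus_one) simp
  thus ?thesis by (simp only: two_eq_0 add_0)
qed

section \<open>Frobenius, trace and norm over \<open>Fq\<close>\<close>

definition fr :: "'a \<Rightarrow> 'a" where "fr x = x ^ q"

lemma power_two_power_add: "(x + y) ^ (2 ^ k) = x ^ (2 ^ k) + (y::'a) ^ (2 ^ k)"
proof (induction k)
  case (Suc k)
  have sq: "(a + b)\<^sup>2 = a\<^sup>2 + (b::'a)\<^sup>2" for a b by (simp add: power2_sum)
  show ?case by (simp add: power_mult power_mult[of _ _ 2] mult.commute[of 2] Suc sq)
qed auto

lemma q_pos: "q > 0" using q_ge by simp

lemma fr_add [simp]: "fr (x + y) = fr x + fr y"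
  using power_two_power_add[of x y m] unfolding fr_def q_eq[symmetric] .
lemma fr_mult [simp]: "fr (x * y) = fr x * fr y" unfolding fr_def by (simp add: power_mult_distrib)
lemma fr_0 [simp]: "fr 0 = 0" using q_pos unfolding fr_def by simp
lemma fr_1 [simp]: "fr 1 = 1" unfolding fr_def by simp
lemma fr_power [simp]: "fr (x ^ n) = fr x ^ n" unfolding fr_def by (simp add: power_mult[symmetric] mult.commute)
lemma fr_inverse [simp]: "fr (inverse x) = inverse (fr x)" unfolding fr_def by (simp add: power_inverse)
lemma fr_divide [simp]: "fr (x / y) = fr x / fr y" unfolding fr_def by (simp add: power_divide)
lemma fr_fr: "fr (fr x) = x ^ q\<^sup>2" unfolding fr_def by (simp add: power_mult[symmetric] power2_eq_square)
lemma fr3 [simp]: "fr (fr (fr x)) = x"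
proof -
  have "fr (fr (fr x)) = x ^ (q ^ 3)" unfolding fr_def by (simp add: power_mult[symmetric] power3_eq_cube)
  thus ?thesis using finite_field_power_card_eq_same[of x] card_UNIV_eq by simp
qed
lemma fr_eq_iff [simp]: "fr x = fr y \<longleftrightarrow> x = y" by (metis fr3)
lemma fr_eq_0_iff [simp]: "fr x = 0 \<longleftrightarrow> x = 0" by (metis fr3 fr_0)

lemma Fq_0 [simp]: "0 \<in> Fq" and Fq_1 [simp]: "1 \<in> Fq"
  and Fq_add: "x \<in> Fq \<Longrightarrow> y \<in> Fq \<Longrightarrow> x + y \<in> Fq"
  and Fq_mult: "x \<in> Fq \<Longrightarrow> y \<in> Fq \<Longrightarrow> x * y \<in> Fq"
  and Fq_inverse: "x \<in> Fq \<Longrightarrow> inverse x \<in> Fq"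
  using subfield_Fq unfolding is_subfield_def by auto

lemma card_roots_le:
  fixes p :: "'a poly" assumes "p \<noteq> 0" shows "card {x. poly p x = 0} \<le> degree p"
  by (simp add: assms card_poly_roots_bound)

text \<open>Multiplication by a nonzero \<open>x\<close> in \<open>Fq\<close> permutes
  \<open>Fq - {0}\<close>, which gives one inclusion; \<open>X^q + X\<close> has at most
  \<open>q\<close> roots, which gives the other.\<close>

lemma Fq_iff: "x \<in> Fq \<longleftrightarrow> fr x = x"
proof -
  have fin: "finite Fq" by simp
  have sub: "Fq \<subseteq> {x. fr x = x}"
  proof
    fix x assume x: "x \<in> Fq"
    show "x \<in> {x. fr x = x}"
    proof (cases "x = 0")
      case False
      have "(\<Prod>y\<in>Fq-{0}. y) = (\<Prod>y\<in>Fq-{0}. x * y)"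
        by (rule prod.reindex_bij_witness[of _ "\<lambda>y. x * y" "\<lambda>y. inverse x * y"])
          (use x False in \<open>auto simp: Fq_mult Fq_inverse mult.assoc[symmetric]\<close>)
      also have "\<dots> = x ^ (q - 1) * (\<Prod>y\<in>Fq-{0}. y)"
        by (simp add: prod.distrib card_Fq)
      finally have "x ^ (q - 1) = 1" by simp
      hence "x ^ Suc (q - 1) = x" by simp
      thus ?thesis using q_pos unfolding fr_def by simp
    qed auto
  qed
  let ?p = "monom 1 q + monom (1::'a) 1"
  have c: "coeff ?p q = 1" using q_ge by simp
  have "degree ?p \<le> q" using q_ge by (intro degree_add_le) (auto simp: degree_monom_eq)
  moreover have "?p \<noteq> 0" by (metis c coeff_0 zero_neq_one)
  hence "card {x. poly ?p x = 0} \<le> degree ?p" by (rule card_roots_le)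
  moreover have "{x. poly ?p x = 0} = {x. fr x = x}" by (auto simp: poly_monom fr_def add_eq_0_char2)
  ultimately have "card {x. fr x = x} \<le> card Fq" using card_Fq by simp
  hence "Fq = {x. fr x = x}" using sub by (intro card_seteq) auto
  thus ?thesis by blast
qed

lemma Fq_fr: "x \<in> Fq \<Longrightarrow> fr x = x" using Fq_iff by blast

definition tr :: "'a \<Rightarrow> 'a" where "tr x = x + fr x + fr (fr x)"
definition nm :: "'a \<Rightarrow> 'a" where "nm x = x * fr x * fr (fr x)"

lemma tr_in_Fq [simp]: "tr x \<in> Fq" unfolding Fq_iff tr_def by (simp add: algebra_simps)
lemma nm_in_Fq [simp]: "nm x \<in> Fq" unfolding Fq_iff nm_def by (simp add: algebra_simps)
lemma tr_add: "tr (x + y) = tr x + tr y" unfolding tr_def by (simp add: algebra_simps)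
lemma tr_0 [simp]: "tr 0 = 0" unfolding tr_def by simp
lemma tr_1 [simp]: "tr 1 = 1" unfolding tr_def by simp
lemma tr_fr [simp]: "tr (fr x) = tr x" unfolding tr_def by (simp add: algebra_simps)
lemma tr_scale: "c \<in> Fq \<Longrightarrow> tr (c * x) = c * tr x" unfolding tr_def Fq_iff by (simp add: algebra_simps)
lemma tr_of_Fq: "c \<in> Fq \<Longrightarrow> tr c = c" unfolding tr_def Fq_iff by simp
lemma tr_sum: "tr (sum f S) = (\<Sum>x\<in>S. tr (f x))"
  by (induction S rule: infinite_finite_induct) (auto simp: tr_add)
lemma nm_mult: "nm (x * y) = nm x * nm y" unfolding nm_def by (simp add: algebra_simps)
lemma nm_0 [simp]: "nm 0 = 0" unfolding nm_def by simp
lemma nm_1 [simp]: "nm 1 = 1" unfolding nm_def by simp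
lemma nm_eq_0_iff [simp]: "nm x = 0 \<longleftrightarrow> x = 0" unfolding nm_def by simp
lemma nm_divide: "nm (x / y) = nm x / nm y" unfolding nm_def by simp
lemma nm_fr [simp]: "nm (fr x) = nm x" unfolding nm_def by (simp add: algebra_simps)

lemma nm_eq_power: "nm x = x ^ (1 + q + q\<^sup>2)"
  unfolding nm_def fr_fr by (simp add: fr_def power_add)

lemma square_eq_iff [simp]: "x\<^sup>2 = y\<^sup>2 \<longleftrightarrow> x = (y::'a)"
proof
  assume "x\<^sup>2 = y\<^sup>2"
  hence "(x + y)\<^sup>2 = 0" by (simp add: power2_sum)
  thus "x = y" by (simp add: add_eq_0_char2)
qed simp

lemma ex_sqrt: "\<exists>y::'a. y\<^sup>2 = x"
proof -
  have "inj (\<lambda>y::'a. y\<^sup>2)" by (rule injI) simp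
  hence "surj (\<lambda>y::'a. y\<^sup>2)" by (rule finite_UNIV_inj_surj[OF finite])
  thus ?thesis by (metis surjD)
qed

lemma Fq_sqrt: "y\<^sup>2 \<in> Fq \<longleftrightarrow> y \<in> Fq"
  unfolding Fq_iff by simp

text \<open>The determinant of the matrix whose rows are \<open>a, b, c\<close> with their conjugates.\<close>
definition det3 :: "'a \<Rightarrow> 'a \<Rightarrow> 'a \<Rightarrow> 'a" where
  "det3 a b c = tr (c * (fr a * fr (fr b) + fr (fr a) * fr b))"

text \<open>One coordinate of a cross product vanishes; conjugating it shows that
  \<open>a / b\<close> is fixed by \<open>fr\<close> applied twice, hence by \<open>fr\<close>,
  which has order three.\<close>

lemma proportional_if_cross_eq_0:
  assumes "fr a * fr (fr b) + fr (fr a) * fr b = 0" "b \<noteq> 0"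
  shows "a / b \<in> Fq"
proof -
  have "fr (fr a * fr (fr b)) = fr (fr (fr a) * fr b)" using assms(1) by (simp add: add_eq_0_char2)
  hence "fr (fr a) * b = a * fr (fr b)" by simp
  hence "fr (fr (a / b)) = a / b" using assms(2) by (simp add: field_simps)
  hence "fr (a / b) = a / b" by (metis fr3)
  thus ?thesis by (simp add: Fq_iff)
qed

text \<open>Take \<open>c\<close> to be the inverse of its own cofactor: the determinant becomes
  \<open>tr 1\<close>, which is one because the degree three is odd.\<close>

lemma ex_det3:
  assumes "b \<noteq> 0" "a / b \<notin> Fq" shows "\<exists>c. det3 a b c = 1"
proof -
  let ?m = "fr a * fr (fr b) + fr (fr a) * fr b"
  have "?m \<noteq> 0" using proportional_if_cross_eq_0 assms by blast
  hence "inverse ?m * ?m = 1" by (rule left_inverse)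
  hence "det3 a b (inverse ?m) = 1" unfolding det3_def by (simp only: tr_1)
  thus ?thesis by blast
qed

text \<open>The functional is \<open>det3\<close> as a function of its first argument, with
  \<open>b\<close> in second place; \<beta> is the cross product of \<open>b\<close> and
  \<open>c\<close>.\<close>

lemma ex_functional:
  assumes "a \<noteq> 0" "b \<noteq> 0" "a / b \<notin> Fq"
  shows "\<exists>\<beta>. tr (\<beta> * a) = 1 \<and> tr (\<beta> * b) = 0"
proof -
  obtain c where c: "det3 a b c = 1" using ex_det3 assms by blast
  have "det3 a b c = tr ((fr b * fr (fr c) + fr (fr b) * fr c) * a)"
    unfolding det3_def tr_def by (simp add: algebra_simps)
  moreover have "tr ((fr b * fr (fr c) + fr (fr b) * fr c) * b) = 0"
    unfolding tr_def by (simp add: algebra_simps)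
  ultimately show ?thesis using c by metis
qed

lemma ex_functional':
  assumes "a \<noteq> 0" "b = 0 \<or> a / b \<notin> Fq"
  shows "\<exists>\<beta>. tr (\<beta> * a) = 1 \<and> tr (\<beta> * b) = 0"
proof (cases "b = 0")
  case True
  have "tr (inverse a * a) = 1" using assms by simp
  thus ?thesis using True by (metis mult_zero_right tr_0)
next
  case False thus ?thesis using ex_functional assms by blast
qed

end

section \<open>Linearized polynomials and ternary cubic forms\<close>

context cubic_extension
begin

text \<open>All \<open>Fq\<close>-linear endomorphisms of the big field have this shape (there are
  \<open>q^9\<close> of either), so coefficient triples replace 3x3 matrices over
  \<open>Fq\<close>.\<close>

definition lin :: "'a \<Rightarrow> 'a \<Rightarrow> 'a \<Rightarrow> 'a \<Rightarrow> 'a" where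
  "lin U V W x = U * x + V * fr x + W * fr (fr x)"

text \<open>The determinant and, below, the sum of the principal 2x2 minors of the Dickson matrix, which represents
  \<open>lin U V W\<close> in the coordinates \<open>x, fr x, fr (fr x)\<close> over the big field.\<close>
definition dickson :: "'a \<Rightarrow> 'a \<Rightarrow> 'a \<Rightarrow> 'a" where
  "dickson U V W = U * (fr U * fr (fr U) + fr V * fr (fr W))
     + V * (fr W * fr (fr U) + fr V * fr (fr V))
     + W * (fr W * fr (fr W) + fr U * fr (fr V))"

definition minors2 :: "'a \<Rightarrow> 'a \<Rightarrow> 'a \<Rightarrow> 'a" where
  "minors2 U V W = tr (U * fr U + V * fr W)"

lemma lin_add: "lin U V W (x + y) = lin U V W x + lin U V W y"
  unfolding lin_def by (simp add: algebra_simps)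
lemma lin_scale: "c \<in> Fq \<Longrightarrow> lin U V W (c * x) = c * lin U V W x"
  unfolding lin_def Fq_iff by (simp add: algebra_simps)
lemma lin_0 [simp]: "lin U V W 0 = 0" unfolding lin_def by simp

lemma lin_comp:
  "lin U V W (lin U' V' W' x) =
     lin (U * U' + V * fr W' + W * fr (fr V')) (U * V' + V * fr U' + W * fr (fr W'))
       (U * W' + V * fr V' + W * fr (fr U')) x"
  unfolding lin_def by (simp add: algebra_simps)

lemma cayley_hamilton:
  "lin U V W (lin U V W (lin U V W x)) =
     tr U * lin U V W (lin U V W x) + minors2 U V W * lin U V W x + dickson U V W * x"
  unfolding lin_def tr_def minors2_def dickson_def by (simp add: algebra_simps)

text \<open>The right-hand side is the characteristic polynomial at \<open>c\<close>; signs are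
  invisible in characteristic two.\<close>

lemma dickson_shift:
  "c \<in> Fq \<Longrightarrow> dickson (U + c) V W = c * c * c + tr U * (c * c) + minors2 U V W * c + dickson U V W"
  unfolding lin_def tr_def minors2_def dickson_def Fq_iff by (simp add: algebra_simps)

lemma det3_lin:
  "det3 (lin U V W a) (lin U V W b) (lin U V W c) = dickson U V W * det3 a b c"
  unfolding lin_def tr_def det3_def dickson_def by (simp add: algebra_simps)

text \<open>With \<open>h\<close> in \<open>Fq\<close> this is the general ternary cubic form over
  \<open>Fq\<close>. In the coordinates \<open>x, fr x, fr (fr x)\<close> the nine monomials other
  than the product of all three form three Frobenius orbits, each needing one coefficient.\<close>

definition cub :: "'a \<Rightarrow> 'a \<Rightarrow> 'a \<Rightarrow> 'a \<Rightarrow> 'a \<Rightarrow> 'a" where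
  "cub \<alpha> \<beta> \<gamma> h x = tr (\<alpha> * (x * x * x) + \<beta> * (x * x * fr x) + \<gamma> * (x * x * fr (fr x))) + h * nm x"

text \<open>Only the monomial with three distinct variables survives full polarization in
  characteristic two, and it yields a permanent, which is the determinant here.\<close>

lemma cub_polarization:
  "cub \<alpha> \<beta> \<gamma> h (a + b + c) + cub \<alpha> \<beta> \<gamma> h (a + b) + cub \<alpha> \<beta> \<gamma> h (a + c) + cub \<alpha> \<beta> \<gamma> h (b + c)
    + cub \<alpha> \<beta> \<gamma> h a + cub \<alpha> \<beta> \<gamma> h b + cub \<alpha> \<beta> \<gamma> h c = h * det3 a b c"
  unfolding cub_def tr_def det3_def nm_def by (simp add: algebra_simps)

lemma ex_not_Fq: "\<exists>a. a \<notin> Fq"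
proof (rule ccontr)
  assume "\<not> ?thesis"
  hence "Fq = UNIV" by blast
  hence "q ^ 3 = q ^ 1" using card_Fq card_UNIV_eq by simp
  moreover have "q > 1" using q_ge by simp
  ultimately show False using power_inject_exp[of q 3 1] by linarith
qed

lemma ex_basis: "\<exists>a b c. det3 a b c = 1"
  using ex_det3[of 1] ex_not_Fq by (metis div_by_1 zero_neq_one)

text \<open>Cramer's rule recovers the coefficients from the values at a basis.\<close>

lemma lin_eq_0_imp:
  assumes "\<And>x. lin U V W x = 0" shows "U = 0 \<and> V = 0 \<and> W = 0"
proof -
  obtain a b c where d: "det3 a b c = 1" using ex_basis by blast
  have "U * det3 a b c = lin U V W a * (fr b * fr (fr c) + fr (fr b) * fr c)
    + lin U V W b * (fr a * fr (fr c) + fr (fr a) * fr c) + lin U V W c * (fr b * fr (fr a) + fr (fr b) * fr a)"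
    unfolding det3_def lin_def tr_def by (simp add: algebra_simps)
  moreover have "V * det3 a b c = lin U V W a * (b * fr (fr c) + fr (fr b) * c)
    + lin U V W b * (a * fr (fr c) + fr (fr a) * c) + lin U V W c * (b * fr (fr a) + fr (fr b) * a)"
    unfolding det3_def lin_def tr_def by (simp add: algebra_simps)
  moreover have "W * det3 a b c = lin U V W a * (b * fr c + fr b * c)
    + lin U V W b * (a * fr c + fr a * c) + lin U V W c * (b * fr a + fr b * a)"
    unfolding det3_def lin_def tr_def by (simp add: algebra_simps)
  ultimately show ?thesis using assms d by simp
qed

lemma lin_diff: "lin U V W x + lin U' V' W' x = lin (U + U') (V + V') (W + W') x"
  unfolding lin_def by (simp add: algebra_simps)

lemma lin_eq_iff: "lin U V W = lin U' V' W' \<longleftrightarrow> U = U' \<and> V = V' \<and> W = W'"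
proof
  assume "lin U V W = lin U' V' W'"
  hence "lin (U + U') (V + V') (W + W') x = 0" for x by (simp add: lin_diff[symmetric])
  thus "U = U' \<and> V = V' \<and> W = W'" using lin_eq_0_imp by (metis add_eq_0_char2)
qed auto

lemma lin_inj_iff: "inj (lin U V W) \<longleftrightarrow> (\<forall>x. lin U V W x = 0 \<longrightarrow> x = 0)"
proof
  assume "inj (lin U V W)" thus "\<forall>x. lin U V W x = 0 \<longrightarrow> x = 0" by (metis injD lin_0)
next
  assume *: "\<forall>x. lin U V W x = 0 \<longrightarrow> x = 0"
  show "inj (lin U V W)"
  proof (rule injI)
    fix x y assume "lin U V W x = lin U V W y"
    hence "lin U V W (x + y) = 0" by (simp add: lin_add)
    thus "x = y" using * add_eq_0_char2 by blast
  qed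
qed

lemma dickson_nonzero_iff: "dickson U V W \<noteq> 0 \<longleftrightarrow> inj (lin U V W)"
proof
  assume d: "dickson U V W \<noteq> 0"
  show "inj (lin U V W)" unfolding lin_inj_iff
  proof (intro allI impI)
    fix x assume "lin U V W x = 0"
    hence "dickson U V W * x = 0" using cayley_hamilton[of U V W x] by simp
    thus "x = 0" using d by simp
  qed
next
  assume "inj (lin U V W)"
  hence s: "surj (lin U V W)" by (rule finite_UNIV_inj_surj[OF finite])
  obtain a b c where d: "det3 a b c = 1" using ex_basis by blast
  obtain a' b' c' where "a = lin U V W a'" "b = lin U V W b'" "c = lin U V W c'" using s by (metis surjD)
  thus "dickson U V W \<noteq> 0" using d det3_lin[of U V W a' b' c'] by auto
qed

lemma eigenvector_if_char_root:
  assumes "c \<in> Fq" "c * c * c + tr U * (c * c) + minors2 U V W * c + dickson U V W = 0"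
  shows "\<exists>d. d \<noteq> 0 \<and> lin U V W d = c * d"
proof -
  have "\<not> inj (lin (U + c) V W)" using assms dickson_shift[of c U V W] dickson_nonzero_iff by metis
  then obtain d where "d \<noteq> 0" "lin (U + c) V W d = 0" unfolding lin_inj_iff by blast
  hence "lin U V W d + c * d = 0" unfolding lin_def by (simp add: algebra_simps)
  thus ?thesis using \<open>d \<noteq> 0\<close> add_eq_0_char2 by blast
qed

lemma cubic_vanishing_on_Fq:
  assumes "\<And>x. x \<in> Fq \<Longrightarrow> p0 + p1 * x + p2 * (x * x) + p3 * (x * x * x) = (0::'a)"
  shows "p0 = 0 \<and> p1 = 0 \<and> p2 = 0 \<and> p3 = 0"
proof -
  let ?p = "[:p0, p1, p2, p3:]"
  have "Fq \<subseteq> {x. poly ?p x = 0}" using assms by (auto simp: algebra_simps)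
  hence le: "q \<le> card {x. poly ?p x = 0}" using card_Fq card_mono[of "{x. poly ?p x = 0}" Fq] by simp
  have "?p = 0"
  proof (rule ccontr)
    assume "?p \<noteq> 0"
    hence "q \<le> degree ?p" using card_roots_le[of ?p] le by simp
    also have "degree ?p \<le> 3" by simp
    finally show False using q_ge by simp
  qed
  thus ?thesis by simp
qed

lemma cub_in_Fq: "h \<in> Fq \<Longrightarrow> cub \<alpha> \<beta> \<gamma> h x \<in> Fq"
  unfolding cub_def by (intro Fq_add Fq_mult) auto

lemma cub_0 [simp]: "cub \<alpha> \<beta> \<gamma> h 0 = 0" unfolding cub_def by simp

lemma cub_scale: "c \<in> Fq \<Longrightarrow> cub \<alpha> \<beta> \<gamma> h (c * x) = c * c * c * cub \<alpha> \<beta> \<gamma> h x"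
  unfolding cub_def tr_def nm_def Fq_iff by (simp add: algebra_simps)

lemma cub_add: "cub \<alpha> \<beta> \<gamma> h x + cub \<alpha>' \<beta>' \<gamma>' h' x = cub (\<alpha> + \<alpha>') (\<beta> + \<beta>') (\<gamma> + \<gamma>') (h + h') x"
  unfolding cub_def tr_def nm_def by (simp add: algebra_simps)

lemma cub_smult: "c \<in> Fq \<Longrightarrow> c * cub \<alpha> \<beta> \<gamma> h x = cub (c * \<alpha>) (c * \<beta>) (c * \<gamma>) (c * h) x"
  unfolding cub_def tr_def nm_def Fq_iff by (simp add: algebra_simps)

text \<open>The polar form of \<open>cub\<close>, quadratic in \<open>v\<close> and linear in
  \<open>w\<close>. Apart from the norm term it is the trace pairing of \<open>w\<close> with a
  linearized polynomial in \<open>v * v\<close>, so nondegeneracy of the trace can be used.\<close>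

definition cubpol :: "'a \<Rightarrow> 'a \<Rightarrow> 'a \<Rightarrow> 'a \<Rightarrow> 'a \<Rightarrow> 'a \<Rightarrow> 'a" where
  "cubpol \<alpha> \<beta> \<gamma> h v w = tr (w * lin \<alpha> (fr \<gamma>) (fr (fr \<beta>)) (v * v)) + h * tr (w * fr v * fr (fr v))"

lemma cub_lincomb:
  assumes "x \<in> Fq" "y \<in> Fq"
  shows "cub \<alpha> \<beta> \<gamma> h (x * v + y * w) =
    cub \<alpha> \<beta> \<gamma> h v * (x * x * x) + cubpol \<alpha> \<beta> \<gamma> h v w * (x * x * y)
     + cubpol \<alpha> \<beta> \<gamma> h w v * (x * y * y) + cub \<alpha> \<beta> \<gamma> h w * (y * y * y)"
  using assms unfolding cub_def cubpol_def lin_def tr_def nm_def Fq_iff by (simp add: algebra_simps)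

text \<open>Polarization gives \<open>h = 0\<close>. Then the polar form vanishes for all
  \<open>w\<close>, and as every element is a square, the linearized polynomial collecting the other
  coefficients is zero.\<close>

lemma cub_eq_0_imp:
  assumes z: "\<And>x. cub \<alpha> \<beta> \<gamma> h x = 0"
  shows "\<alpha> = 0 \<and> \<beta> = 0 \<and> \<gamma> = 0 \<and> h = 0"
proof -
  obtain a b c where "det3 a b c = 1" using ex_basis by blast
  hence h: "h = 0" using cub_polarization[of \<alpha> \<beta> \<gamma> h a b c] z by simp
  have "lin \<alpha> (fr \<gamma>) (fr (fr \<beta>)) u = 0" for u
  proof (rule ccontr)
    assume ne: "lin \<alpha> (fr \<gamma>) (fr (fr \<beta>)) u \<noteq> 0"
    obtain v where v: "u = v * v" using ex_sqrt[of u] by (metis power2_eq_square)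
    define w where "w = inverse (lin \<alpha> (fr \<gamma>) (fr (fr \<beta>)) u)"
    have "cubpol \<alpha> \<beta> \<gamma> h v w = 1" using ne h unfolding cubpol_def v w_def by simp
    moreover have "0 + cubpol \<alpha> \<beta> \<gamma> h w v * x + cubpol \<alpha> \<beta> \<gamma> h v w * (x * x) + 0 * (x * x * x) = 0"
      if "x \<in> Fq" for x
      using cub_lincomb[of x 1 \<alpha> \<beta> \<gamma> h v w] that z by (simp add: algebra_simps)
    hence "cubpol \<alpha> \<beta> \<gamma> h v w = 0" using cubic_vanishing_on_Fq by blast
    ultimately show False by simp
  qed
  hence "\<alpha> = 0 \<and> fr \<gamma> = 0 \<and> fr (fr \<beta>) = 0" by (rule lin_eq_0_imp)
  thus ?thesis using h by simp
qed

lemma cub_eq_imp: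
  assumes "\<And>x. cub \<alpha> \<beta> \<gamma> h x = cub \<alpha>' \<beta>' \<gamma>' h' x"
  shows "\<alpha> = \<alpha>' \<and> \<beta> = \<beta>' \<and> \<gamma> = \<gamma>' \<and> h = h'"
proof -
  have "cub (\<alpha> + \<alpha>') (\<beta> + \<beta>') (\<gamma> + \<gamma>') (h + h') x = 0" for x
    using assms by (simp add: cub_add[symmetric])
  from cub_eq_0_imp[OF this] show ?thesis by (simp add: add_eq_0_char2)
qed

lemma tr_monomials_eq_cub:
  "tr (p0 * (x * x * x) + p1 * (fr x * fr x * fr x) + p2 * (fr (fr x) * fr (fr x) * fr (fr x))
     + p3 * (x * x * fr x) + p4 * (fr x * fr x * fr (fr x)) + p5 * (fr (fr x) * fr (fr x) * x)
     + p6 * (x * x * fr (fr x)) + p7 * (fr x * fr x * x) + p8 * (fr (fr x) * fr (fr x) * fr x)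
     + p9 * (x * fr x * fr (fr x)))
   = cub (p0 + fr (fr p1) + fr p2) (p3 + fr (fr p4) + fr p5) (p6 + fr (fr p7) + fr p8) (tr p9) x"
  unfolding cub_def tr_def nm_def by (simp add: algebra_simps)

lemma tr_prod_lin_eq_cub:
  "\<exists>\<alpha> \<beta> \<gamma> h. h \<in> Fq \<and> (\<forall>x. tr (c * lin U1 V1 W1 x * lin U2 V2 W2 x * lin U3 V3 W3 x) = cub \<alpha> \<beta> \<gamma> h x)"
proof -
  have "c * lin U1 V1 W1 x * lin U2 V2 W2 x * lin U3 V3 W3 x =
     (c * U1 * U2 * U3) * (x * x * x) + (c * V1 * V2 * V3) * (fr x * fr x * fr x)
     + (c * W1 * W2 * W3) * (fr (fr x) * fr (fr x) * fr (fr x))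
     + (c * (U1 * U2 * V3 + U1 * V2 * U3 + V1 * U2 * U3)) * (x * x * fr x)
     + (c * (V1 * V2 * W3 + V1 * W2 * V3 + W1 * V2 * V3)) * (fr x * fr x * fr (fr x))
     + (c * (W1 * W2 * U3 + W1 * U2 * W3 + U1 * W2 * W3)) * (fr (fr x) * fr (fr x) * x)
     + (c * (U1 * U2 * W3 + U1 * W2 * U3 + W1 * U2 * U3)) * (x * x * fr (fr x))
     + (c * (V1 * V2 * U3 + V1 * U2 * V3 + U1 * V2 * V3)) * (fr x * fr x * x)
     + (c * (W1 * W2 * V3 + W1 * V2 * W3 + V1 * W2 * W3)) * (fr (fr x) * fr (fr x) * fr x)
     + (c * (U1 * V2 * W3 + U1 * W2 * V3 + V1 * U2 * W3 + V1 * W2 * U3 + W1 * U2 * V3 + W1 * V2 * U3))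
        * (x * fr x * fr (fr x))" for x
    unfolding lin_def by (simp add: algebra_simps)
  note expand = this
  show ?thesis unfolding expand tr_monomials_eq_cub
    by (rule exI)+ (intro conjI allI, rule tr_in_Fq, rule refl)
qed

text \<open>The conjugates \<open>Y\<close> and \<open>Z\<close> of a linearized polynomial are
  linearized again, so every summand becomes the trace of a product of three linearized
  polynomials.\<close>

lemma cub_comp_lin:
  assumes "h \<in> Fq"
  shows "\<exists>\<alpha>' \<beta>' \<gamma>' h'. h' \<in> Fq \<and> (\<forall>x. cub \<alpha> \<beta> \<gamma> h (lin U V W x) = cub \<alpha>' \<beta>' \<gamma>' h' x)"
proof -
  define X Y Z where "X = lin U V W" and "Y = lin (fr W) (fr U) (fr V)" and "Z = lin (fr (fr V)) (fr (fr W)) (fr (fr U))"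
  have Y: "fr (X x) = Y x" and Z: "fr (Y x) = Z x" for x
    unfolding X_def Y_def Z_def lin_def by (simp_all add: algebra_simps)
  have "h * nm (X x) = tr (h * X x * Y x * Z x)" for x
  proof -
    have "tr (h * nm (X x)) = h * nm (X x)" using assms by (intro tr_of_Fq Fq_mult) auto
    moreover have "h * nm (X x) = h * X x * Y x * Z x" by (simp add: nm_def Y Z mult.assoc)
    ultimately show ?thesis by simp
  qed
  hence e: "cub \<alpha> \<beta> \<gamma> h (X x) = tr (\<alpha> * X x * X x * X x) + tr (\<beta> * X x * X x * Y x) + tr (\<gamma> * X x * X x * Z x)
      + tr (h * X x * Y x * Z x)" for x
    unfolding cub_def tr_add Y Z by (simp add: mult.assoc)
  obtain a1 b1 c1 h1 where 1: "h1 \<in> Fq" "\<And>x. tr (\<alpha> * X x * X x * X x) = cub a1 b1 c1 h1 x"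
    using tr_prod_lin_eq_cub unfolding X_def by metis
  obtain a2 b2 c2 h2 where 2: "h2 \<in> Fq" "\<And>x. tr (\<beta> * X x * X x * Y x) = cub a2 b2 c2 h2 x"
    using tr_prod_lin_eq_cub unfolding X_def Y_def by metis
  obtain a3 b3 c3 h3 where 3: "h3 \<in> Fq" "\<And>x. tr (\<gamma> * X x * X x * Z x) = cub a3 b3 c3 h3 x"
    using tr_prod_lin_eq_cub unfolding X_def Z_def by metis
  obtain a4 b4 c4 h4 where 4: "h4 \<in> Fq" "\<And>x. tr (h * X x * Y x * Z x) = cub a4 b4 c4 h4 x"
    using tr_prod_lin_eq_cub unfolding X_def Y_def Z_def by metis
  show ?thesis unfolding X_def[symmetric] e 1 2 3 4 cub_add using 1 2 3 4 Fq_add by metis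
qed

end

section \<open>Symmetries of an anisotropic cubic form\<close>

context cubic_extension
begin

text \<open>As \<open>q^2\<close> is one modulo three, \<open>fr\<close> applied twice fixes
  \<open>k\<close>; since \<open>fr\<close> has order three, so does \<open>fr\<close>.\<close>

lemma cube_eq_1_in_Fq:
  assumes "k * k * k = (1::'a)" shows "k \<in> Fq"
proof -
  have "q\<^sup>2 mod 3 = 1"
  proof -
    have "q mod 3 = 1 \<or> q mod 3 = 2"
    proof -
      have "\<not> 3 dvd q" unfolding q_eq using prime_dvd_power[of "3::nat" 2 m] by auto
      thus ?thesis by presburger
    qed
    moreover have "q\<^sup>2 mod 3 = (q mod 3) * (q mod 3) mod 3" by (simp add: power2_eq_square mod_mult_eq)
    ultimately show ?thesis by auto
  qed
  then obtain r where r: "q\<^sup>2 = 3 * r + 1" by (metis mult_div_mod_eq)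
  have k3: "k ^ 3 = 1" using assms by (simp add: power3_eq_cube)
  have "fr (fr k) = k" unfolding fr_fr r by (simp add: power_add power_mult k3)
  hence "fr k = k" by (metis fr3)
  thus ?thesis by (simp add: Fq_iff)
qed

definition anisotropic :: "('a \<Rightarrow> 'a) \<Rightarrow> bool" where
  "anisotropic T \<longleftrightarrow> (\<forall>x. x \<noteq> 0 \<longrightarrow> T x \<noteq> 0)"

end

section \<open>Symmetries in general, and symmetries with an eigenvector over
  \<open>Fq\<close>\<close>

locale cubic_symmetry = cubic_extension m q Fq
  for m q :: nat and Fq :: "'a::finite_field set" +
  fixes \<alpha> \<beta> \<gamma> h U V W :: 'a
  assumes h_Fq: "h \<in> Fq" and h_nonzero: "h \<noteq> 0"
    and aniso: "anisotropic (cub \<alpha> \<beta> \<gamma> h)"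
    and invariant: "cub \<alpha> \<beta> \<gamma> h (lin U V W x) = cub \<alpha> \<beta> \<gamma> h x"
begin

abbreviation T where "T \<equiv> cub \<alpha> \<beta> \<gamma> h"
abbreviation s where "s \<equiv> lin U V W"

lemma T_nonzero: "x \<noteq> 0 \<Longrightarrow> T x \<noteq> 0"
  using aniso unfolding anisotropic_def by blast

lemma s_inj: "inj s"
  unfolding lin_inj_iff using T_nonzero invariant cub_0 by metis

text \<open>The polarization of the form is \<open>h * det3\<close>; invariance of the form passes
  to it, and \<open>h\<close> cancels.\<close>

lemma dickson_eq_1: "dickson U V W = 1"
proof -
  obtain a b c where d: "det3 a b c = 1" using ex_basis by blast
  have "h * det3 (s a) (s b) (s c) = h * det3 a b c"
    unfolding cub_polarization[symmetric, of h _ _ _ \<alpha> \<beta> \<gamma>] lin_add[symmetric] invariant ..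
  thus ?thesis using h_nonzero d by (simp add: det3_lin)
qed

lemma cayley_hamilton_s: "s (s (s x)) = tr U * s (s x) + minors2 U V W * s x + x"
  using cayley_hamilton[of U V W x] dickson_eq_1 by simp

lemma eigenvalue_cube:
  assumes "c \<in> Fq" "d \<noteq> 0" "s d = c * d" shows "c * c * c = 1"
proof -
  have "T (c * d) = T d" using invariant[of d] assms(3) by simp
  hence "c * c * c * T d = T d" using cub_scale[OF assms(1)] by simp
  thus ?thesis using T_nonzero[OF assms(2)] by simp
qed

text \<open>In the characteristic equation at \<open>c\<close>, the terms \<open>c * c * c\<close>
  and the determinant are both one and cancel.\<close>

lemma eigenvalue_minors:
  assumes "c \<in> Fq" "d \<noteq> 0" "s d = c * d" shows "minors2 U V W = tr U * c"
proof -
  have e: "s d = c * d" "s (c * y) = c * s y" for y using assms lin_scale by auto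
  have c3: "c * (c * c) = 1" using eigenvalue_cube[OF assms] by (simp add: mult.assoc)
  have "c * (c * c) * d = tr U * (c * (c * d)) + minors2 U V W * (c * d) + d"
    using cayley_hamilton_s[of d] by (simp add: e mult.assoc)
  hence "d = tr U * (c * (c * d)) + minors2 U V W * (c * d) + d" unfolding c3 by simp
  hence "tr U * (c * (c * d)) + minors2 U V W * (c * d) = 0" by (metis add_cancel_left_left add.commute)
  hence "(tr U * c + minors2 U V W) * (c * d) = 0" by (simp add: algebra_simps)
  moreover have "c \<noteq> 0" using c3 by auto
  ultimately show ?thesis using assms(2) add_eq_0_char2 by (metis mult_eq_0_iff)
qed

end

context cubic_extension
begin

text \<open>Along a line in the direction of the image of a nilpotent part, an invariant form is a cubic
  polynomial with a nonzero period, which is impossible.\<close>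
lemma no_translation_symmetry:
  assumes an: "anisotropic (cub \<alpha> \<beta> \<gamma> h)" and v: "v \<noteq> 0" and k: "k \<in> Fq" "k \<noteq> 0"
    and inv: "\<And>x. x \<in> Fq \<Longrightarrow> cub \<alpha> \<beta> \<gamma> h (a + (x + k) * v) = cub \<alpha> \<beta> \<gamma> h (a + x * v)"
  shows False
proof -
  let ?T = "cub \<alpha> \<beta> \<gamma> h"
  define P Q where "P = cubpol \<alpha> \<beta> \<gamma> h a v" and "Q = cubpol \<alpha> \<beta> \<gamma> h v a"
  have ex: "?T (a + y * v) = ?T a + P * y + Q * (y * y) + ?T v * (y * y * y)" if "y \<in> Fq" for y
    using cub_lincomb[of 1 y \<alpha> \<beta> \<gamma> h a v] that unfolding P_def Q_def by simp
  \<comment> \<open>The difference of the two cubics in \<open>x\<close> has degree at most two,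
    with leading coefficient \<open>?T v * k\<close> because three equals one.\<close>
  have "(P * k + Q * (k * k) + ?T v * (k * k * k)) + (?T v * (k * k)) * x + (?T v * k) * (x * x) + 0 * (x * x * x) = 0"
    if x: "x \<in> Fq" for x
  proof -
    have "?T (a + (x + k) * v) + ?T (a + x * v) = 0" using inv[OF x] by simp
    thus ?thesis unfolding ex[OF x] ex[OF Fq_add[OF x k(1)]] by (simp add: algebra_simps)
  qed
  hence "?T v * k = 0" using cubic_vanishing_on_Fq by blast
  thus False using an v k unfolding anisotropic_def by auto
qed

end

context cubic_symmetry
begin

text \<open>The vector \<open>v = s a + c * a\<close> is an eigenvector, and on the line
  \<open>a + x * v\<close> the map \<open>s\<close> is scaling by \<open>c\<close> after the shift
  of \<open>x\<close> by \<open>inverse c\<close>. Since \<open>c\<close> is a cube root of one,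
  scaling by \<open>c\<close> does not change the form, so the shift is a period.\<close>

lemma no_unipotent:
  assumes c: "c \<in> Fq" and nil: "\<And>x. s (s x) = c * c * x" and ne: "s a \<noteq> c * a"
  shows False
proof -
  define v where "v = s a + c * a"
  have v: "v \<noteq> 0" using ne unfolding v_def by (simp add: add_eq_0_char2)
  have sv: "s v = c * v" unfolding v_def lin_add lin_scale[OF c] nil by (simp add: algebra_simps)
  have c3: "c * c * c = 1" using eigenvalue_cube[OF c v sv] .
  have cinv: "inverse c \<in> Fq" "inverse c \<noteq> 0" using c c3 Fq_inverse by auto
  show False
  proof (rule no_translation_symmetry[OF aniso v cinv])
    fix x assume x: "x \<in> Fq"
    have "c \<noteq> 0" using c3 by auto
    hence cc: "c * inverse c = 1" by (rule right_inverse)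
    have "s (a + x * v) = s a + x * (c * v)" by (simp add: lin_add lin_scale[OF x] sv)
    also have "\<dots> = c * (a + x * v) + v" by (simp add: v_def algebra_simps)
    also have "\<dots> = c * (a + x * v) + (c * inverse c) * v" by (simp only: cc mult_1)
    also have "\<dots> = c * (a + (x + inverse c) * v)" by (simp only: algebra_simps)
    finally have "T (c * (a + (x + inverse c) * v)) = T (a + x * v)" using invariant[of "a + x * v"] by simp
    thus "T (a + (x + inverse c) * v) = T (a + x * v)" unfolding cub_scale[OF c] c3 by simp
  qed
qed

lemma square_symmetry:
  obtains U' V' W' where "\<And>x. lin U' V' W' x = s (s x)" "cubic_symmetry m q Fq \<alpha> \<beta> \<gamma> h U' V' W'"
proof -
  obtain U' V' W' where e: "\<And>x. lin U' V' W' x = s (s x)" using lin_comp by metis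
  have "cubic_symmetry m q Fq \<alpha> \<beta> \<gamma> h U' V' W'"
    by unfold_locales (simp_all add: h_Fq h_nonzero aniso e invariant)
  thus ?thesis using that e by blast
qed

text \<open>The restriction of the form to the invariant plane spanned by \<open>w\<close> and \<open>s w\<close> is a binary cubic,
  and invariance is a condition on its coefficients.\<close>
lemma plane_recurrence:
  assumes b: "b \<in> Fq" and c: "c \<in> Fq" "c * c * c = 1"
    and w: "w \<noteq> 0" and indep: "s w \<noteq> 0" and rec: "s (s w) = b * s w + c * c * w"
  shows "b = 0 \<or> b = c"
proof -
  define w' where "w' = s w"
  define P Q where "P = cubpol \<alpha> \<beta> \<gamma> h w w'" and "Q = cubpol \<alpha> \<beta> \<gamma> h w' w"
  define D where "D = T w"
  have Dw': "T w' = D" unfolding D_def w'_def by (rule invariant)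
  have D: "D \<noteq> 0" unfolding D_def using T_nonzero w by blast
  have ex: "T (x * w + y * w') = D * (x * x * x) + P * (x * x * y) + Q * (x * y * y) + D * (y * y * y)"
    if "x \<in> Fq" "y \<in> Fq" for x y
    using cub_lincomb[OF that, of \<alpha> \<beta> \<gamma> h w w'] unfolding P_def Q_def Dw' D_def[symmetric] .
  have c6: "c * c * (c * c) * (c * c) = 1" using c(2) by (metis mult.assoc mult_1)
  \<comment> \<open>This is invariance along the affine line \<open>x * w + w'\<close>, on which the
    cubic terms cancel; the coefficients of \<open>x\<close> and \<open>x * x\<close> are what is
    used.\<close>
  have "(b * b * b * D + P * b * (c * c * (c * c)) + Q * (c * c * (b * b))) + (D * (b * b) + P * (c * c * (c * c)) + Q) * x
      + (D * b + Q * (c * c) + P) * (x * x) + 0 * (x * x * x) = 0"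
    if x: "x \<in> Fq" for x
  proof -
    have mem: "c * c \<in> Fq" "x + b \<in> Fq" using b c x Fq_add Fq_mult by auto
    have "s (x * w + 1 * w') = (c * c) * w + (x + b) * w'"
      unfolding w'_def lin_add lin_scale[OF x] using rec by (simp add: algebra_simps)
    hence "T ((c * c) * w + (x + b) * w') + T (x * w + 1 * w') = 0" using invariant[of "x * w + 1 * w'"] by simp
    hence "(D * (c * c * (c * c) * (c * c)) + P * (c * c * (c * c) * (x + b)) + Q * (c * c * (x + b) * (x + b)) + D * ((x + b) * (x + b) * (x + b)))
      + (D * (x * x * x) + P * (x * x * 1) + Q * (x * 1 * 1) + D * (1 * 1 * 1)) = 0"
      unfolding ex[OF mem] ex[OF x Fq_1] .
    thus ?thesis unfolding c6 by (simp add: algebra_simps)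
  qed
  hence e1: "D * (b * b) + P * (c * c * (c * c)) + Q = 0" and e2: "D * b + Q * (c * c) + P = 0"
    using cubic_vanishing_on_Fq by blast+
  have c4: "c * c * (c * c) = c" using c(2) by (metis mult.assoc mult_1_right)
  hence e1: "D * (b * b) + P * c + Q = 0" using e1 by (simp only: c4)
  have Q: "Q = D * (b * b) + P * c" using e1 by (metis add_eq_0_char2)
  have "D * (b * (1 + b * (c * c))) + P * (1 + c * c * c) = 0"
    using e2 unfolding Q by (simp add: algebra_simps)
  hence "b * (1 + b * (c * c)) = 0" using D c(2) by simp
  hence "b = 0 \<or> b * (c * c) = 1" by (metis add_eq_0_char2 mult_eq_0_iff)
  moreover have "b = c" if "b * (c * c) = 1"
    using that c(2) by (metis mult.assoc mult.commute mult_1)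
  ultimately show ?thesis by blast
qed

text \<open>The characteristic polynomial is \<open>X + c\<close> times
  \<open>X^2 + b * X + c^2\<close> with \<open>b = tr U + c\<close>, and the quadratic factor
  annihilates the image of \<open>s + c\<close>. By \<open>plane_recurrence\<close>,
  \<open>b = c\<close>, which is trace zero, or \<open>b = 0\<close>; in the latter case
  \<open>s\<close> or its square would be excluded by \<open>no_unipotent\<close>.\<close>

lemma trace_eq_0_if_eigenvector:
  assumes c: "c \<in> Fq" and d: "d \<noteq> 0" "s d = c * d" and ne: "s a \<noteq> c * a"
  shows "tr U = 0"
proof (rule ccontr)
  assume tr0: "tr U \<noteq> 0"
  define b where "b = tr U + c"
  have c3: "c * c * c = 1" by (rule eigenvalue_cube[OF c d])
  have b: "b \<in> Fq" unfolding b_def using c by (intro Fq_add) auto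
  have mi: "minors2 U V W = tr U * c" by (rule eigenvalue_minors[OF c d])
  have rec: "s (s w) = b * s w + c * c * w" if w: "w = s x + c * x" for w x
  proof -
    have "s (s w) + b * s w + c * c * w = c * c * c * x + x"
      unfolding w lin_add lin_scale[OF c] cayley_hamilton_s mi b_def by (simp add: algebra_simps)
    hence "s (s w) + (b * s w + c * c * w) = 0" by (simp add: c3 add.assoc)
    thus ?thesis by (simp add: add_eq_0_char2)
  qed
  define w where "w = s a + c * a"
  have w: "w \<noteq> 0" unfolding w_def using ne by (simp add: add_eq_0_char2)
  have "s w \<noteq> 0" using w s_inj lin_inj_iff by blast
  hence "b = 0 \<or> b = c" using plane_recurrence[OF b c c3 w] rec[OF w_def] by blast
  moreover have "b \<noteq> c" using tr0 unfolding b_def by auto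
  ultimately have b0: "b = 0" by blast
  hence trc: "tr U = c" unfolding b_def by (metis add_eq_0_char2)
  have ss: "s (s (s x)) = c * s (s x) + c * c * s x + x" for x
    using cayley_hamilton_s[of x] mi trc by simp
  show False
  proof (cases "\<forall>x. s (s x) = c * c * x")
    case True thus False using no_unipotent[OF c _ ne] by blast
  next
    case False
    then obtain y where y: "s (s y) \<noteq> (c * c) * y" by blast
    obtain U' V' W' where e: "\<And>x. lin U' V' W' x = s (s x)" and sy: "cubic_symmetry m q Fq \<alpha> \<beta> \<gamma> h U' V' W'"
      by (rule square_symmetry) blast
    interpret sq: cubic_symmetry m q Fq \<alpha> \<beta> \<gamma> h U' V' W' by (rule sy)
    \<comment> \<open>Now the characteristic polynomial is the cube of \<open>X + c\<close>, so its
      fourth power \<open>X^4 + c^4\<close> annihilates \<open>s\<close> as well.\<close>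
    have "s (s (s (s x))) = (c * c) * (c * c) * x" for x
    proof -
      have "s (s (s (s x))) = c * s (s (s x)) + c * c * s (s x) + s x" by (rule ss)
      also have "\<dots> = c * x + (c * c * c) * s x + s x" unfolding ss by (simp add: algebra_simps)
      also have "\<dots> = (c * c * c) * (c * x)" unfolding c3 by simp
      finally show ?thesis by (simp add: algebra_simps)
    qed
    thus False using sq.no_unipotent[of "c * c" y] e y c Fq_mult by auto
  qed
qed

end

section \<open>Inverses, sums and powers of linearized maps; power sums\<close>

context cubic_extension
begin

lemma dickson_in_Fq [simp]: "dickson U V W \<in> Fq"
  unfolding Fq_iff dickson_def by (simp add: algebra_simps)

lemma minors2_in_Fq [simp]: "minors2 U V W \<in> Fq"
  unfolding minors2_def by simp

text \<open>By Cayley-Hamilton the inverse is a polynomial in the map itself, divided by the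
  determinant, hence linearized too.\<close>

lemma lin_inverse:
  assumes "inj (lin U V W)"
  obtains U' V' W' where "\<And>x. lin U V W (lin U' V' W' x) = x" "\<And>x. lin U' V' W' (lin U V W x) = x"
proof -
  define d where "d = inverse (dickson U V W)"
  have d: "d \<in> Fq" "d * dickson U V W = 1"
    using assms dickson_nonzero_iff unfolding d_def by (auto simp: Fq_inverse)
  let ?l = "lin U V W"
  obtain A B C where sq: "\<And>x. ?l (?l x) = lin A B C x" using lin_comp by metis
  define l' where "l' = lin (d * (A + tr U * U + minors2 U V W)) (d * (B + tr U * V)) (d * (C + tr U * W))"
  have l': "l' x = d * (?l (?l x) + tr U * ?l x + minors2 U V W * x)" for x
    unfolding l'_def sq by (simp add: lin_def algebra_simps)
  have "l' (?l x) = x" for x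
  proof -
    have "l' (?l x) = d * (dickson U V W * x)"
      unfolding l' cayley_hamilton by (simp add: algebra_simps)
    also have "\<dots> = x" using d by (simp add: mult.assoc[symmetric])
    finally show ?thesis .
  qed
  moreover have "?l (l' x) = x" for x
  proof -
    have "?l (l' x) = l' (?l x)"
      unfolding l' by (simp add: lin_add lin_scale[OF d(1)] lin_scale[OF tr_in_Fq] lin_scale[OF minors2_in_Fq])
    thus ?thesis using \<open>l' (?l x) = x\<close> by simp
  qed
  ultimately show ?thesis using that unfolding l'_def by blast
qed

lemma lin_sum_form:
  fixes n :: nat
  shows "\<exists>A B C. \<forall>x. (\<Sum>i<n. c i * lin (U i) (V i) (W i) x) = lin A B C x"
proof (induction n)
  case 0
  have "\<forall>x. (\<Sum>i<0::nat. c i * lin (U i) (V i) (W i) x) = lin 0 0 0 x" by (simp add: lin_def)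
  thus ?case by blast
next
  case (Suc n)
  then obtain A B C where "\<And>x. (\<Sum>i<n. c i * lin (U i) (V i) (W i) x) = lin A B C x" by blast
  hence "\<forall>x. (\<Sum>i<Suc n. c i * lin (U i) (V i) (W i) x)
     = lin (A + c n * U n) (B + c n * V n) (C + c n * W n) x" by (simp add: lin_def algebra_simps)
  thus ?case by blast
qed

lemma lin_funpow_form: "\<exists>A B C. \<forall>x. (lin U V W ^^ i) x = lin A B C x"
proof (induction i)
  case 0
  have "\<forall>x. (lin U V W ^^ 0) x = lin 1 0 0 x" by (simp add: lin_def)
  thus ?case by blast
next
  case (Suc i)
  then obtain A B C where "\<And>x. (lin U V W ^^ i) x = lin A B C x" by blast
  hence "\<And>x. (lin U V W ^^ Suc i) x = lin (U * A + V * fr C + W * fr (fr B))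
      (U * B + V * fr A + W * fr (fr C)) (U * C + V * fr B + W * fr (fr A)) x"
    by (simp add: lin_comp)
  thus ?case by blast
qed

text \<open>Scaling by some \<open>t\<close> with \<open>t ^ i \<noteq> 1\<close> multiplies the sum
  by \<open>t ^ i\<close>; such a \<open>t\<close> exists because \<open>X^i + 1\<close> has too few
  roots.\<close>

lemma sum_powers_eq_0:
  assumes "0 < i" "i < q ^ 3 - 1"
  shows "(\<Sum>k\<in>UNIV - {0::'a}. k ^ i) = 0"
proof -
  have "\<exists>t::'a. t \<noteq> 0 \<and> t ^ i \<noteq> 1"
  proof (rule ccontr)
    assume "\<not> ?thesis"
    hence sub: "UNIV - {0} \<subseteq> {x::'a. poly (monom 1 i + 1) x = 0}" by (auto simp: poly_monom)
    have "coeff (monom 1 i + (1::'a poly)) i = 1" using assms by simp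
    hence "monom 1 i + (1::'a poly) \<noteq> 0" by (metis coeff_0 zero_neq_one)
    hence "card {x::'a. poly (monom 1 i + 1) x = 0} \<le> degree (monom 1 i + (1::'a poly))" by (rule card_roots_le)
    also have "\<dots> \<le> i" by (intro degree_add_le) (auto simp: degree_monom_eq)
    finally have "card (UNIV - {0::'a}) \<le> i" using card_mono[OF _ sub] by simp
    thus False using assms card_UNIV_eq by (simp add: card_Diff_singleton)
  qed
  then obtain t :: 'a where t: "t \<noteq> 0" "t ^ i \<noteq> 1" by blast
  have "(\<Sum>k\<in>UNIV - {0::'a}. k ^ i) = (\<Sum>k\<in>UNIV - {0::'a}. (t * k) ^ i)"
    by (rule sum.reindex_bij_witness[of _ "\<lambda>k. t * k" "\<lambda>k. inverse t * k"])
      (use t in \<open>auto simp: mult.assoc[symmetric]\<close>)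
  also have "\<dots> = t ^ i * (\<Sum>k\<in>UNIV - {0::'a}. k ^ i)" by (simp add: power_mult_distrib sum_distrib_left)
  finally have "(t ^ i + 1) * (\<Sum>k\<in>UNIV - {0::'a}. k ^ i) = 0"
    by (metis add_self distrib_right mult_1)
  thus ?thesis using t by (simp add: add_eq_0_char2)
qed

lemma cub_mult:
  "cub \<alpha> \<beta> \<gamma> h (k * x) = cub (\<alpha> * (k * k * k)) (\<beta> * (k * k * fr k)) (\<gamma> * (k * k * fr (fr k))) (h * nm k) x"
  unfolding cub_def tr_def nm_def by (simp add: algebra_simps)

end

section \<open>Symmetries without eigenvectors over \<open>Fq\<close> force a norm form\<close>

locale eigenvector_free_symmetry = cubic_symmetry m q Fq \<alpha> \<beta> \<gamma> h U V W
  for m q :: nat and Fq :: "'a::finite_field set" and \<alpha> \<beta> \<gamma> h U V W +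
  assumes no_eigenvector: "c \<in> Fq \<Longrightarrow> d \<noteq> 0 \<Longrightarrow> s d \<noteq> c * d"
begin

lemma independent2:
  assumes "a \<noteq> 0" "x \<in> Fq" "y \<in> Fq" "x * a + y * s a = 0"
  shows "x = 0 \<and> y = 0"
proof -
  have "y = 0"
  proof (rule ccontr)
    assume y: "y \<noteq> 0"
    have "y * s a = x * a" using assms(4) by (metis add_eq_0_char2)
    hence "s a = (inverse y * x) * a" using y by (metis left_inverse mult.assoc mult_1)
    thus False using no_eigenvector assms Fq_mult Fq_inverse by blast
  qed
  thus ?thesis using assms by simp
qed

text \<open>Every nonzero vector is cyclic. Otherwise \<open>s\<close> satisfies a quadratic
  relation on \<open>a\<close>; dividing the characteristic polynomial by that quadratic leaves a
  linear factor with root \<open>r = tr U + y'\<close>, and a root in \<open>Fq\<close> brings an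
  eigenvector.\<close>

lemma independent3:
  assumes a: "a \<noteq> 0" and xyz: "x \<in> Fq" "y \<in> Fq" "z \<in> Fq" and eq: "x * a + y * s a + z * s (s a) = 0"
  shows "x = 0 \<and> y = 0 \<and> z = 0"
proof -
  have "z = 0"
  proof (rule ccontr)
    assume z: "z \<noteq> 0"
    define x' y' where "x' = inverse z * x" and "y' = inverse z * y"
    have Fq': "x' \<in> Fq" "y' \<in> Fq" unfolding x'_def y'_def using xyz Fq_mult Fq_inverse by auto
    have "z * s (s a) = x * a + y * s a" using eq by (metis add_eq_0_char2)
    hence "s (s a) = inverse z * (x * a + y * s a)" using z by (metis left_inverse mult.assoc mult_1)
    hence ss: "s (s a) = x' * a + y' * s a" unfolding x'_def y'_def by (simp add: algebra_simps)
    define r where "r = tr U + y'"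
    have rF: "r \<in> Fq" unfolding r_def using Fq' by (intro Fq_add) auto
    have trU: "tr U = r + y'" unfolding r_def by (simp add: algebra_simps)
    have s3: "s (s (s a)) = x' * s a + y' * s (s a)" by (simp add: ss lin_add lin_scale Fq')
    have "x' * s a + y' * s (s a) = tr U * s (s a) + minors2 U V W * s a + a"
      using cayley_hamilton_s[of a] unfolding s3 .
    hence "(x' * s a + y' * s (s a)) + (tr U * s (s a) + minors2 U V W * s a + a) = 0" by (simp only: add_self)
    hence "(r * x' + 1) * a + (r * y' + x' + minors2 U V W) * s a = 0"
      unfolding ss trU by (simp add: algebra_simps)
    hence "r * x' + 1 = 0 \<and> r * y' + x' + minors2 U V W = 0"
      by (intro independent2[OF a]) (auto intro!: Fq_add Fq_mult rF Fq')
    hence "1 = r * x'" "minors2 U V W = r * y' + x'" by (metis add_eq_0_char2)+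
    hence "r * r * r + tr U * (r * r) + minors2 U V W * r + dickson U V W = 0"
      unfolding dickson_eq_1 trU by (simp add: algebra_simps)
    from eigenvector_if_char_root[OF rF this] show False using no_eigenvector rF by blast
  qed
  thus ?thesis using independent2[OF a xyz(1,2)] eq by simp
qed

lemma cyclic_span:
  assumes a: "a \<noteq> 0"
  shows "\<exists>x\<in>Fq. \<exists>y\<in>Fq. \<exists>z\<in>Fq. v = x * a + y * s a + z * s (s a)"
proof -
  let ?F = "\<lambda>(x, y, z). x * a + y * s a + z * s (s a)"
  have "inj_on ?F (Fq \<times> Fq \<times> Fq)"
  proof (rule inj_onI)
    fix p p' assume pp': "p \<in> Fq \<times> Fq \<times> Fq" "p' \<in> Fq \<times> Fq \<times> Fq" "?F p = ?F p'"
    obtain x y z x' y' z' where p: "p = (x, y, z)" "p' = (x', y', z')" by (cases p, cases p') blast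
    have mem: "x \<in> Fq" "y \<in> Fq" "z \<in> Fq" "x' \<in> Fq" "y' \<in> Fq" "z' \<in> Fq"
      and "x * a + y * s a + z * s (s a) = x' * a + y' * s a + z' * s (s a)" using pp' unfolding p by auto
    hence "(x * a + y * s a + z * s (s a)) + (x' * a + y' * s a + z' * s (s a)) = 0" by (simp only: add_self)
    hence "(x + x') * a + (y + y') * s a + (z + z') * s (s a) = 0" by (simp add: algebra_simps)
    hence "x + x' = 0 \<and> y + y' = 0 \<and> z + z' = 0"
      using mem by (intro independent3[OF a]) (auto intro: Fq_add)
    thus "p = p'" unfolding p by (simp add: add_eq_0_char2)
  qed
  hence "card (?F ` (Fq \<times> Fq \<times> Fq)) = CARD('a)"
    by (simp add: card_image card_cartesian_product card_Fq card_UNIV_eq power3_eq_cube)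
  hence "?F ` (Fq \<times> Fq \<times> Fq) = UNIV" by (simp add: card_eq_UNIV_imp_eq_UNIV)
  hence "v \<in> ?F ` (Fq \<times> Fq \<times> Fq)" by blast
  thus ?thesis by auto
qed

lemma funpow_s_lincomb:
  assumes "x \<in> Fq" "y \<in> Fq" "z \<in> Fq"
  shows "(s ^^ i) (x * a + y * b + z * c) = x * (s ^^ i) a + y * (s ^^ i) b + z * (s ^^ i) c"
  by (induction i) (simp_all add: lin_add lin_scale assms)

lemma funpow_fixed:
  assumes "a \<noteq> 0" "(s ^^ i) a = a" shows "(s ^^ i) v = v"
proof -
  obtain x y z where v: "x \<in> Fq" "y \<in> Fq" "z \<in> Fq" "v = x * a + y * s a + z * s (s a)"
    using cyclic_span[OF assms(1)] by blast
  have "(s ^^ i) (s b) = s ((s ^^ i) b)" for b by (simp add: funpow_swap1)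
  thus ?thesis unfolding v(4) funpow_s_lincomb[OF v(1-3)] using assms(2) by simp
qed

text \<open>A power of \<open>s\<close> fixing one nonzero vector is the identity, by cyclicity. So
  all orbits on nonzero vectors have the same length \<open>N\<close>, and \<open>N\<close> divides
  \<open>q ^ 3 - 1\<close>.\<close>

lemma s_period: "(s ^^ (q ^ 3 - 1)) v = v"
proof -
  have "finite {y. \<exists>n. y = (s ^^ n) 1}" by simp
  from funpow_inj_finite[OF s_inj this] obtain n0 where "n0 > 0" "(s ^^ n0) 1 = 1" by blast
  hence ex: "\<exists>n. n > 0 \<and> (s ^^ n) 1 = 1" by blast
  define N where "N = (LEAST n. n > 0 \<and> (s ^^ n) 1 = 1)"
  have N: "N > 0" "(s ^^ N) 1 = 1" using LeastI_ex[OF ex] unfolding N_def by auto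
  have least: "n \<ge> N" if "n > 0" "(s ^^ n) 1 = 1" for n
    unfolding N_def by (rule Least_le) (use that in auto)
  have sN: "(s ^^ N) v = v" for v using funpow_fixed[OF _ N(2)] by simp
  have sNmult: "(s ^^ (N * j)) v = v" for v j by (induction j) (simp_all add: funpow_add sN)
  define Orb where "Orb = (\<lambda>a. (\<lambda>i. (s ^^ i) a) ` {..<N})"
  have card_Orb: "card (Orb a) = N" if a: "a \<noteq> 0" for a
  proof -
    have lt: False if ij: "i < j" "j < N" "(s ^^ i) a = (s ^^ j) a" for i j
    proof -
      have "(s ^^ j) a = (s ^^ i) ((s ^^ (j - i)) a)"
        using ij by (metis funpow_add le_add_diff_inverse less_imp_le o_apply)
      hence "(s ^^ i) ((s ^^ (j - i)) a) = (s ^^ i) a" using ij by simp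
      hence "(s ^^ (j - i)) a = a" using inj_fn[OF s_inj] by (metis injD)
      hence "(s ^^ (j - i)) 1 = 1" by (rule funpow_fixed[OF a])
      thus False using least[of "j - i"] ij by simp
    qed
    have "inj_on (\<lambda>i. (s ^^ i) a) {..<N}"
    proof (rule inj_onI)
      fix i j assume "i \<in> {..<N}" "j \<in> {..<N}" "(s ^^ i) a = (s ^^ j) a"
      thus "i = j" using lt[of i j] lt[of j i] by (cases i j rule: linorder_cases) auto
    qed
    thus ?thesis unfolding Orb_def by (simp add: card_image)
  qed
  have Orb_all: "(s ^^ i) a \<in> Orb a" for i a
  proof -
    have "(s ^^ i) a = (s ^^ (i mod N)) ((s ^^ (N * (i div N))) a)"
      by (metis funpow_add o_apply mod_mult_div_eq)
    hence "(s ^^ i) a = (s ^^ (i mod N)) a" unfolding sNmult .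
    thus ?thesis unfolding Orb_def using N by auto
  qed
  have Orb_sub: "Orb b \<subseteq> Orb a" if b: "b \<in> Orb a" for a b
  proof
    fix c assume "c \<in> Orb b"
    then obtain i j where "b = (s ^^ i) a" "c = (s ^^ j) b" using b unfolding Orb_def by auto
    hence "c = (s ^^ (j + i)) a" by (simp add: funpow_add)
    thus "c \<in> Orb a" using Orb_all by simp
  qed
  have Orb_sym: "a \<in> Orb b" if b: "b \<in> Orb a" for a b
  proof -
    obtain i where i: "b = (s ^^ i) a" "i < N" using b unfolding Orb_def by auto
    have "(s ^^ (N - i)) b = (s ^^ ((N - i) + i)) a" unfolding funpow_add by (simp add: i(1))
    hence "(s ^^ (N - i)) b = (s ^^ N) a" using i(2) by simp
    thus ?thesis using Orb_all[of "N - i" b] sN by simp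
  qed
  have Orb_eq: "Orb b = Orb a" if "b \<in> Orb a" for a b using Orb_sub[OF that] Orb_sub[OF Orb_sym[OF that]] by blast
  have self: "a \<in> Orb a" for a using Orb_all[of 0 a] by simp
  have nz: "(s ^^ i) a \<noteq> 0" if "a \<noteq> 0" for i a
  proof -
    have "s x \<noteq> 0" if "x \<noteq> 0" for x using that s_inj lin_inj_iff by blast
    thus ?thesis by (induction i) (simp_all add: that)
  qed
  let ?C = "Orb ` (UNIV - {0})"
  have un: "\<Union> ?C = UNIV - {0}"
  proof
    show "\<Union> ?C \<subseteq> UNIV - {0}" unfolding Orb_def using nz by auto
    show "UNIV - {0} \<subseteq> \<Union> ?C" using self by blast
  qed
  have "N * card ?C = card (\<Union> ?C)"
  proof (rule card_partition)
    show "finite ?C" "finite (\<Union> ?C)" by simp_all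
    show "card c = N" if "c \<in> ?C" for c using that card_Orb by auto
    show "c1 \<inter> c2 = {}" if c12: "c1 \<in> ?C" "c2 \<in> ?C" "c1 \<noteq> c2" for c1 c2
    proof (rule ccontr)
      assume "c1 \<inter> c2 \<noteq> {}"
      then obtain b where "b \<in> c1" "b \<in> c2" by blast
      thus False using c12 Orb_eq by (metis imageE)
    qed
  qed
  hence "N * card ?C = q ^ 3 - 1" unfolding un using card_UNIV_eq by (simp add: card_Diff_singleton)
  thus ?thesis using sNmult by metis
qed

text \<open>Discrete Fourier transform along the orbits of the symmetry, whose order divides \<^term>\<open>q ^ 3 - 1\<close>:
  the components are eigenfunctionals, and they add up to the identity.\<close>
lemma ex_eigenfunctional:
  "\<exists>k A B C. (\<forall>x. lin A B C (s x) = k * lin A B C x) \<and> lin A B C 1 \<noteq> 0"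
proof -
  define n where "n = q ^ 3 - 1"
  have "1 < q ^ 3" by (rule one_less_power) (use q_ge in auto)
  hence n: "n = CARD('a) - 1" "n > 0" unfolding n_def card_UNIV_eq by auto
  define l where "l = (\<lambda>k x. \<Sum>i<n. inverse k ^ i * (s ^^ i) x)"
  have eig: "l k (s x) = k * l k x" if k: "k \<noteq> 0" for k x
  proof -
    define t where "t = (\<lambda>i. inverse k ^ i * (s ^^ i) x)"
    have kn: "k ^ n = 1"
    proof -
      have "k * k ^ n = k ^ CARD('a)" using n by (metis Suc_pred' power_Suc zero_less_card_finite One_nat_def)
      also have "\<dots> = k" by (rule finite_field_power_card_eq_same)
      finally show ?thesis using k by simp
    qed
    have tn: "t n = t 0" unfolding t_def using kn s_period by (simp add: n_def power_inverse)
    have "l k (s x) = (\<Sum>i<n. k * t (Suc i))"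
      unfolding l_def t_def using k by (intro sum.cong refl) (simp add: funpow_swap1)
    also have "\<dots> = k * (\<Sum>i<n. t (Suc i))" by (simp add: sum_distrib_left)
    also have "(\<Sum>i<n. t (Suc i)) = (\<Sum>i<n. t i)"
      using sum.lessThan_Suc_shift[of t n] sum.lessThan_Suc[of t n] tn by (simp add: add.commute)
    finally show ?thesis unfolding l_def t_def .
  qed
  have "(\<Sum>k\<in>UNIV - {0}. l k 1) = (\<Sum>i<n. (\<Sum>k\<in>UNIV - {0::'a}. inverse k ^ i) * (s ^^ i) 1)"
    unfolding l_def by (subst sum.swap) (simp add: sum_distrib_right)
  also have "\<dots> = (\<Sum>i<n. (\<Sum>k\<in>UNIV - {0::'a}. k ^ i) * (s ^^ i) 1)"
  proof (rule sum.cong[OF refl], rule arg_cong2[where f="(*)", OF _ refl])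
    fix i show "(\<Sum>k\<in>UNIV - {0::'a}. inverse k ^ i) = (\<Sum>k\<in>UNIV - {0::'a}. k ^ i)"
      by (rule sum.reindex_bij_witness[of _ inverse inverse]) auto
  qed
  \<comment> \<open>Only the exponent zero survives, where the inner sum counts the \<open>n\<close>
    nonzero elements; \<open>n + 1 = q ^ 3\<close> is even, so the total is one.\<close>
  also have "\<dots> = (\<Sum>i<n. if i = 0 then of_nat n else 0)"
    by (intro sum.cong refl) (auto simp: sum_powers_eq_0 n_def card_UNIV_eq card_Diff_singleton)
  also have "\<dots> = of_nat n" using n by simp
  also have "\<dots> = (1::'a)"
  proof -
    have "of_nat (n + 1) = (0::'a)" unfolding n_def
      using q_ge m_ge by (simp add: q_eq)
    thus ?thesis by (simp add: add_eq_0_char2)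
  qed
  finally obtain k where k: "k \<noteq> 0" "l k 1 \<noteq> 0" by (metis (no_types, lifting) DiffE sum.neutral insertI1 zero_neq_one)
  have "\<exists>a b c. \<forall>x. (s ^^ i) x = lin a b c x" for i by (rule lin_funpow_form)
  then obtain a b c where abc: "\<And>i x. (s ^^ i) x = lin (a i) (b i) (c i) x" by metis
  obtain A B C where ABC: "\<And>x. l k x = lin A B C x"
    unfolding l_def abc using lin_sum_form by metis
  show ?thesis using eig[OF k(1)] k(2) unfolding ABC by blast
qed

text \<open>In the coordinate given by the eigenfunctional, \<open>s\<close> is multiplication by
  some \<open>k\<close> outside \<open>Fq\<close>. Invariance multiplies the four coefficients by
  \<open>k^3\<close>, \<open>k * k * fr k\<close>, \<open>k * k * fr (fr k)\<close> and
  \<open>nm k\<close>. The last is one, since polarization carries \<open>h \<noteq> 0\<close> over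
  to \<open>d\<close>; any other being one would put \<open>k\<close> into \<open>Fq\<close>, so
  only the norm term remains.\<close>

lemma norm_form:
  obtains c A B C where "inj (lin A B C)" "\<And>x. T x = c * nm (lin A B C x)"
proof -
  obtain k A B C where eig: "\<And>x. lin A B C (s x) = k * lin A B C x" and ne: "lin A B C 1 \<noteq> 0"
    using ex_eigenfunctional by blast
  let ?l = "lin A B C"
  have inj: "inj ?l" unfolding lin_inj_iff
  proof (intro allI impI, rule ccontr)
    fix a assume a: "?l a = 0" "a \<noteq> 0"
    obtain x y z where "x \<in> Fq" "y \<in> Fq" "z \<in> Fq" "1 = x * a + y * s a + z * s (s a)"
      using cyclic_span[OF a(2)] by blast
    hence "?l 1 = x * ?l a + y * ?l (s a) + z * ?l (s (s a))" by (metis lin_add lin_scale)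
    thus False using ne a(1) by (simp add: eig)
  qed
  have kF: "k \<notin> Fq"
  proof
    assume k: "k \<in> Fq"
    hence "?l (s 1) = ?l (k * 1)" using lin_scale eig by metis
    hence "s 1 = k * 1" using inj by (metis injD)
    thus False using no_eigenvector[OF k] by (metis zero_neq_one)
  qed
  obtain A' B' C' where inv: "\<And>x. ?l (lin A' B' C' x) = x" "\<And>x. lin A' B' C' (?l x) = x"
    using lin_inverse[OF inj] by blast
  obtain a b c d where T': "\<And>x. T (lin A' B' C' x) = cub a b c d x" using cub_comp_lin[OF h_Fq] by metis
  have Tl: "T x = cub a b c d (?l x)" for x using T'[of "?l x"] inv by simp
  have d: "d \<noteq> 0"
  proof
    assume d: "d = 0"
    obtain u v w where "det3 u v w = 1" using ex_basis by blast
    hence "h = d * det3 (?l u) (?l v) (?l w)"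
      using cub_polarization[of \<alpha> \<beta> \<gamma> h u v w] cub_polarization[of a b c d "?l u" "?l v" "?l w"]
      by (simp add: Tl lin_add)
    thus False using d h_nonzero by simp
  qed
  have "cub a b c d (k * x) = cub a b c d x" for x
    using invariant[of "lin A' B' C' x"] unfolding Tl eig inv .
  hence "cub (a * (k * k * k)) (b * (k * k * fr k)) (c * (k * k * fr (fr k))) (d * nm k) x = cub a b c d x" for x
    by (simp add: cub_mult)
  from cub_eq_imp[OF this]
  have e: "a * (k * k * k) = a" "b * (k * k * fr k) = b" "c * (k * k * fr (fr k)) = c" "d * nm k = d" by auto
  have nk: "k * fr k * fr (fr k) = 1" using e(4) d unfolding nm_def by simp
  have knz: "k \<noteq> 0" "fr k \<noteq> 0" "fr (fr k) \<noteq> 0" using nk by auto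
  have a: "a = 0" using e(1) kF cube_eq_1_in_Fq by (metis mult_cancel_left1 mult.commute)
  have b: "b = 0"
  proof (rule ccontr)
    assume "b \<noteq> 0"
    hence "k * k * fr k = k * fr k * fr (fr k)" using e(2) nk by simp
    hence "k = fr (fr k)" using knz by simp
    hence "fr k = k" by (metis fr3)
    thus False using kF Fq_iff by blast
  qed
  have c: "c = 0"
  proof (rule ccontr)
    assume "c \<noteq> 0"
    hence "k * k * fr (fr k) = k * fr k * fr (fr k)" using e(3) nk by simp
    hence "k = fr k" using knz by simp
    thus False using kF Fq_iff by metis
  qed
  have "T x = d * nm (?l x)" for x unfolding Tl a b c by (simp add: cub_def)
  thus ?thesis using that inj by blast
qed

end

section \<open>Counting symmetries\<close>

context cubic_symmetry
begin

lemma trace_eq_0_or_norm_form: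
  assumes nonscalar: "\<And>c. c \<in> Fq \<Longrightarrow> \<exists>a. s a \<noteq> c * a"
    and not_norm: "\<And>c A B C. inj (lin A B C) \<Longrightarrow> \<exists>x. T x \<noteq> c * nm (lin A B C x)"
  shows "tr U = 0"
proof (cases "\<exists>c\<in>Fq. \<exists>d. d \<noteq> 0 \<and> s d = c * d")
  case True
  thus ?thesis using trace_eq_0_if_eigenvector nonscalar by blast
next
  case False
  interpret eigenvector_free_symmetry m q Fq \<alpha> \<beta> \<gamma> h U V W
    by unfold_locales (use False in blast)
  show ?thesis using norm_form not_norm by metis
qed

end

context cubic_extension
begin

abbreviation lin3 :: "'a \<times> 'a \<times> 'a \<Rightarrow> 'a \<Rightarrow> 'a" where
  "lin3 p \<equiv> lin (fst p) (fst (snd p)) (snd (snd p))"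

text \<open>The trace of \<open>lin3 p \<circ> lin3 p'\<close>.\<close>
definition trace_form :: "'a \<times> 'a \<times> 'a \<Rightarrow> 'a \<times> 'a \<times> 'a \<Rightarrow> 'a" where
  "trace_form p p' = tr (fst p * fst p' + fst (snd p) * fr (snd (snd p')) + snd (snd p) * fr (fr (fst (snd p'))))"

lemma trace_form_eq:
  assumes "\<And>x. lin3 p (lin3 p' x) = lin A B C x" shows "trace_form p p' = tr A"
proof -
  have "lin (fst p * fst p' + fst (snd p) * fr (snd (snd p')) + snd (snd p) * fr (fr (fst (snd p'))))
     (fst p * fst (snd p') + fst (snd p) * fr (fst p') + snd (snd p) * fr (fr (snd (snd p'))))
     (fst p * snd (snd p') + fst (snd p) * fr (fst (snd p')) + snd (snd p) * fr (fr (fst p'))) = lin A B C"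
    using assms unfolding lin_comp by (rule ext)
  thus ?thesis unfolding lin_eq_iff trace_form_def by simp
qed

lemma trace_form_sum:
  assumes "\<And>g. g \<in> F \<Longrightarrow> c g \<in> Fq"
  shows "trace_form (\<Sum>g\<in>F. c g * fst g, \<Sum>g\<in>F. c g * fst (snd g), \<Sum>g\<in>F. c g * snd (snd g)) p
     = (\<Sum>g\<in>F. c g * trace_form g p)"
proof -
  have "trace_form (\<Sum>g\<in>F. c g * fst g, \<Sum>g\<in>F. c g * fst (snd g), \<Sum>g\<in>F. c g * snd (snd g)) p
    = (\<Sum>g\<in>F. tr (c g * (fst g * fst p + fst (snd g) * fr (snd (snd p)) + snd (snd g) * fr (fr (fst (snd p))))))"
    unfolding trace_form_def fst_conv snd_conv
    by (simp only: sum_distrib_right sum.distrib[symmetric] tr_sum ring_distribs mult.assoc)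
  also have "\<dots> = (\<Sum>g\<in>F. c g * trace_form g p)"
    unfolding trace_form_def by (intro sum.cong refl tr_scale assms)
  finally show ?thesis .
qed

definition proportional :: "'a \<times> 'a \<times> 'a \<Rightarrow> 'a \<times> 'a \<times> 'a \<Rightarrow> bool" where
  "proportional g g' \<longleftrightarrow> (\<exists>c\<in>Fq. \<forall>x. lin3 g x = c * lin3 g' x)"

definition symmetries :: "('a \<Rightarrow> 'a) \<Rightarrow> ('a \<times> 'a \<times> 'a) set" where
  "symmetries T = {g. \<forall>x. T (lin3 g x) = T x}"

definition is_norm_form :: "('a \<Rightarrow> 'a) \<Rightarrow> bool" where
  "is_norm_form T \<longleftrightarrow> (\<exists>c A B C. inj (lin A B C) \<and> (\<forall>x. T x = c * nm (lin A B C x)))"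

text \<open>For distinct \<open>g\<close> and \<open>j\<close> in \<open>F\<close>, the symmetry
  \<open>g\<close> after the inverse of \<open>j\<close> is not scalar and has trace zero, while the
  identity has trace three, that is one. Pairing with the inverses thus recovers coefficients, and
  \<open>Fq\<close>-combinations of \<open>F\<close> inject into the \<open>q ^ 9\<close>
  triples.\<close>

lemma card_independent_symmetries:
  assumes T: "anisotropic (cub \<alpha> \<beta> \<gamma> h)" "h \<in> Fq" "h \<noteq> 0" "\<not> is_norm_form (cub \<alpha> \<beta> \<gamma> h)"
    and F: "F \<subseteq> symmetries (cub \<alpha> \<beta> \<gamma> h)"
    and indep: "\<And>g g'. g \<in> F \<Longrightarrow> g' \<in> F \<Longrightarrow> proportional g g' \<Longrightarrow> g = g'"
  shows "card F \<le> 9"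
proof -
  let ?T = "cub \<alpha> \<beta> \<gamma> h"
  have sym: "cubic_symmetry m q Fq \<alpha> \<beta> \<gamma> h U V W" if "\<And>x. ?T (lin U V W x) = ?T x" for U V W
    using that T by unfold_locales auto
  have "\<exists>p. (\<forall>x. lin3 g (lin3 p x) = x) \<and> (\<forall>x. lin3 p (lin3 g x) = x)" if "g \<in> F" for g
  proof -
    have "inj (lin3 g)" by (rule cubic_symmetry.s_inj[OF sym]) (use F that in \<open>auto simp: symmetries_def\<close>)
    from lin_inverse[OF this] show ?thesis by (metis fst_conv snd_conv)
  qed
  then obtain iv where iv: "\<And>g x. g \<in> F \<Longrightarrow> lin3 g (lin3 (iv g) x) = x"
      "\<And>g x. g \<in> F \<Longrightarrow> lin3 (iv g) (lin3 g x) = x" by metis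
  have tf: "trace_form g (iv j) = (if g = j then 1 else 0)" if gj: "g \<in> F" "j \<in> F" for g j
  proof (cases "g = j")
    case True
    have "lin3 g (lin3 (iv g) x) = lin 1 0 0 x" for x using iv gj by (simp add: lin_def)
    from trace_form_eq[OF this] show ?thesis using True by simp
  next
    case False
    obtain A B C where ABC: "\<And>x. lin3 g (lin3 (iv j) x) = lin A B C x" using lin_comp by metis
    have "?T (lin A B C x) = ?T x" for x
    proof -
      have "?T (lin A B C x) = ?T (lin3 (iv j) x)" unfolding ABC[symmetric] using gj F by (auto simp: symmetries_def)
      also have "\<dots> = ?T (lin3 j (lin3 (iv j) x))" using gj F by (auto simp: symmetries_def)
      finally show ?thesis using iv gj by simp
    qed
    then interpret cubic_symmetry m q Fq \<alpha> \<beta> \<gamma> h A B C by (rule sym)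
    have "tr A = 0"
    proof (rule trace_eq_0_or_norm_form)
      fix c assume c: "c \<in> Fq"
      show "\<exists>a. lin A B C a \<noteq> c * a"
      proof (rule ccontr)
        assume "\<not> (\<exists>a. lin A B C a \<noteq> c * a)"
        hence "lin3 g x = c * lin3 j x" for x using ABC[of "lin3 j x"] iv gj by simp
        hence "proportional g j" using c unfolding proportional_def by blast
        thus False using indep gj False by blast
      qed
    next
      fix c A B C assume "inj (lin A B C)"
      thus "\<exists>x. ?T x \<noteq> c * nm (lin A B C x)" using T(4) unfolding is_norm_form_def by blast
    qed
    thus ?thesis using trace_form_eq[OF ABC] False by simp
  qed
  define \<Phi> where "\<Phi> = (\<lambda>c. (\<Sum>g\<in>F. c g * fst g, \<Sum>g\<in>F. c g * fst (snd g), \<Sum>g\<in>F. c g * snd (snd g)))"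
  have coeff: "trace_form (\<Phi> c) (iv j) = c j" if "c \<in> F \<rightarrow>\<^sub>E Fq" "j \<in> F" for c j
  proof -
    have "trace_form (\<Phi> c) (iv j) = (\<Sum>g\<in>F. c g * trace_form g (iv j))"
      unfolding \<Phi>_def by (rule trace_form_sum) (use that in auto)
    also have "\<dots> = (\<Sum>g\<in>F. if g = j then c g else 0)" by (intro sum.cong refl) (simp add: tf that)
    finally show ?thesis using that by simp
  qed
  have "inj_on \<Phi> (F \<rightarrow>\<^sub>E Fq)"
    by (rule inj_onI, rule PiE_ext) (auto simp: coeff[symmetric])
  hence "card (F \<rightarrow>\<^sub>E Fq) \<le> CARD('a \<times> 'a \<times> 'a)" by (metis card_image card_mono finite subset_UNIV)
  hence "q ^ card F \<le> q ^ 9" by (simp add: card_PiE card_Fq card_UNIV_eq power_add[symmetric])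
  thus ?thesis by (rule power_le_imp_le_exp[rotated]) (use q_ge in simp)
qed

lemma card_cube_roots_of_1: "card {c::'a. c * c * c = 1} \<le> 3"
proof -
  have "{c::'a. c * c * c = 1} = {c. poly [:1, 0, 0, 1:] c = 0}"
    by (auto simp: add_eq_0_char2 mult.assoc)
  moreover have "card {c. poly [:1, 0, 0, 1::'a:] c = 0} \<le> degree [:1, 0, 0, 1::'a:]"
    by (rule card_roots_le) simp
  ultimately show ?thesis by simp
qed

text \<open>Each symmetry is a multiple of a member of a maximal pairwise non-proportional set, and
  invariance makes the factor a cube root of one: at most 9 times 3.\<close>

lemma card_symmetries:
  assumes T: "anisotropic (cub \<alpha> \<beta> \<gamma> h)" "h \<in> Fq" "h \<noteq> 0" "\<not> is_norm_form (cub \<alpha> \<beta> \<gamma> h)"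
  shows "card (symmetries (cub \<alpha> \<beta> \<gamma> h)) \<le> 27"
proof -
  let ?T = "cub \<alpha> \<beta> \<gamma> h"
  let ?S = "symmetries ?T"
  define Fs where "Fs = {F. F \<subseteq> ?S \<and> (\<forall>g\<in>F. \<forall>g'\<in>F. proportional g g' \<longrightarrow> g = g')}"
  have "Fs \<noteq> {}" unfolding Fs_def by blast
  then obtain F where F: "F \<in> Fs" and max: "\<And>F'. F' \<in> Fs \<Longrightarrow> card F' \<le> card F"
    using obtains_MAX[of Fs card] by (metis Max_ge finite_imageI finite imageI)
  have cov: "\<exists>f\<in>F. proportional g f" if g: "g \<in> ?S" for g
  proof (rule ccontr)
    assume no: "\<not> ?thesis"
    have refl: "proportional x x" for x unfolding proportional_def by (rule bexI[of _ 1]) auto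
    have symm: "proportional y x" if xy: "proportional x y" and xS: "x \<in> ?S" for x y
    proof -
      obtain c where c: "c \<in> Fq" "\<And>z. lin3 x z = c * lin3 y z" using xy unfolding proportional_def by blast
      have "c \<noteq> 0"
      proof
        assume "c = 0"
        hence "?T (lin3 x 1) = 0" using c(2) by simp
        thus False using xS T(1) unfolding symmetries_def anisotropic_def by auto
      qed
      hence "lin3 y z = inverse c * lin3 x z" for z by (simp add: c(2) mult.assoc[symmetric])
      thus ?thesis using Fq_inverse[OF c(1)] unfolding proportional_def by blast
    qed
    have "insert g F \<in> Fs" using F g no symm unfolding Fs_def by blast
    hence "card (insert g F) \<le> card F" by (rule max)
    moreover have "g \<notin> F" using no refl by blast
    ultimately show False by simp
  qed
  have "card F \<le> 9" using F by (intro card_independent_symmetries[OF T]) (auto simp: Fs_def)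
  define R where "R = {c::'a. c * c * c = 1}"
  let ?mul = "\<lambda>(f :: 'a \<times> 'a \<times> 'a) c. (c * fst f, c * fst (snd f), c * snd (snd f))"
  have "?S \<subseteq> (\<Union>f\<in>F. ?mul f ` R)"
  proof
    fix g assume g: "g \<in> ?S"
    obtain f c where f: "f \<in> F" "c \<in> Fq" "\<And>x. lin3 g x = c * lin3 f x"
      using cov[OF g] unfolding proportional_def by blast
    have fS: "f \<in> ?S" using F f unfolding Fs_def by blast
    have "?T 1 = ?T (lin3 g 1)" using g unfolding symmetries_def by simp
    also have "\<dots> = c * c * c * ?T (lin3 f 1)" unfolding f(3) by (rule cub_scale[OF f(2)])
    also have "?T (lin3 f 1) = ?T 1" using fS unfolding symmetries_def by simp
    finally have "?T 1 = c * c * c * ?T 1" .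
    moreover have "?T 1 \<noteq> 0" using T(1) unfolding anisotropic_def by simp
    ultimately have "c \<in> R" unfolding R_def by simp
    have "lin3 g x = lin3 (?mul f c) x" for x unfolding f(3) by (simp add: lin_def algebra_simps)
    hence "lin3 g = lin3 (?mul f c)" by (rule ext)
    hence "g = ?mul f c" unfolding lin_eq_iff by (simp add: prod_eq_iff)
    with \<open>c \<in> R\<close> show "g \<in> (\<Union>f\<in>F. ?mul f ` R)" using f(1) by blast
  qed
  hence "card ?S \<le> card (\<Union>f\<in>F. ?mul f ` R)" by (intro card_mono) auto
  also have "\<dots> \<le> (\<Sum>f\<in>F. card (?mul f ` R))" by (rule card_UN_le) simp
  also have "\<dots> \<le> (\<Sum>f\<in>F. 3)"
  proof (rule sum_mono)
    fix f
    have "card (?mul f ` R) \<le> card R" by (rule card_image_le) simp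
    also have "\<dots> \<le> 3" unfolding R_def by (rule card_cube_roots_of_1)
    finally show "card (?mul f ` R) \<le> 3" .
  qed
  also have "\<dots> \<le> 27" using \<open>card F \<le> 9\<close> by simp
  finally show ?thesis .
qed

definition anisotropic_cubics :: "('a \<Rightarrow> 'a) set" where
  "anisotropic_cubics = {T. anisotropic T \<and> (\<exists>\<alpha> \<beta> \<gamma>. \<exists>h\<in>Fq. T = cub \<alpha> \<beta> \<gamma> h)}"

lemma card_le_fibers:
  assumes "finite A" "\<And>y. card {x \<in> A. f x = y} \<le> k"
  shows "card A \<le> k * card (f ` A)"
proof -
  have "card A = card (\<Union>y\<in>f ` A. {x \<in> A. f x = y})" by (rule arg_cong[where f=card]) auto
  also have "\<dots> \<le> (\<Sum>y\<in>f ` A. card {x \<in> A. f x = y})" using assms by (intro card_UN_le) auto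
  also have "\<dots> \<le> (\<Sum>y\<in>f ` A. k)" using assms by (intro sum_mono) auto
  finally show ?thesis by (simp add: mult.commute)
qed

text \<open>Orbit counting: composing the fibre of \<open>g \<mapsto> T \<circ> g\<close> through
  \<open>g0\<close> with the inverse of \<open>g0\<close> maps it injectively into the
  symmetries.\<close>

lemma card_invertible_le:
  assumes T: "anisotropic (cub \<alpha> \<beta> \<gamma> h)" "h \<in> Fq" "h \<noteq> 0" "\<not> is_norm_form (cub \<alpha> \<beta> \<gamma> h)"
  shows "card {g. inj (lin3 g)} \<le> 27 * card anisotropic_cubics"
proof -
  let ?T = "cub \<alpha> \<beta> \<gamma> h"
  let ?G = "{g. inj (lin3 g)}"
  let ?f = "\<lambda>g x. ?T (lin3 g x)"
  have "card ?G \<le> 27 * card (?f ` ?G)"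
  proof (rule card_le_fibers)
    fix \<tau>
    show "card {g \<in> ?G. ?f g = \<tau>} \<le> 27"
    proof (cases "{g \<in> ?G. ?f g = \<tau>} = {}")
      case True
      show ?thesis unfolding True by simp
    next
      case False
      then obtain g0 where g0: "inj (lin3 g0)" "?f g0 = \<tau>" by blast
      obtain A B C where iv: "\<And>x. lin3 g0 (lin A B C x) = x" "\<And>x. lin A B C (lin3 g0 x) = x"
        using lin_inverse[OF g0(1)] by blast
      have "\<forall>g. \<exists>p. \<forall>x. lin3 g (lin A B C x) = lin3 p x"
        using lin_comp by (metis fst_conv snd_conv)
      then obtain c where c: "\<And>g x. lin3 g (lin A B C x) = lin3 (c g) x" by metis
      have "inj c"
      proof (rule injI)
        fix g g' assume "c g = c g'"
        hence "lin3 g (lin A B C x) = lin3 g' (lin A B C x)" for x unfolding c by simp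
        hence "lin3 g x = lin3 g' x" for x by (metis iv(2))
        hence "lin3 g = lin3 g'" by (rule ext)
        thus "g = g'" unfolding lin_eq_iff by (simp add: prod_eq_iff)
      qed
      moreover have "c ` {g \<in> ?G. ?f g = \<tau>} \<subseteq> symmetries ?T"
      proof (rule image_subsetI)
        fix g assume g: "g \<in> {g \<in> ?G. ?f g = \<tau>}"
        have fg: "?f g = ?f g0" using g g0(2) by simp
        have "?T (lin3 (c g) x) = ?T x" for x
        proof -
          have "?T (lin3 (c g) x) = ?f g (lin A B C x)" unfolding c ..
          also have "\<dots> = ?f g0 (lin A B C x)" by (rule fun_cong[OF fg])
          finally show ?thesis unfolding iv .
        qed
        thus "c g \<in> symmetries ?T" unfolding symmetries_def by blast
      qed
      ultimately have "card {g \<in> ?G. ?f g = \<tau>} \<le> card (symmetries ?T)"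
        by (intro card_inj_on_le[of c]) (auto intro: inj_on_subset)
      thus ?thesis using card_symmetries[OF T] by linarith
    qed
  qed simp
  also have "card (?f ` ?G) \<le> card anisotropic_cubics"
  proof (rule card_mono)
    show "?f ` ?G \<subseteq> anisotropic_cubics"
    proof (rule image_subsetI)
      fix g assume g: "g \<in> ?G"
      hence "anisotropic (?f g)" using T(1) unfolding anisotropic_def lin_inj_iff by blast
      moreover obtain a b c d where "d \<in> Fq" "\<And>x. ?f g x = cub a b c d x" using cub_comp_lin[OF T(2)] by metis
      hence "\<exists>a b c. \<exists>d\<in>Fq. ?f g = cub a b c d" by blast
      ultimately show "?f g \<in> anisotropic_cubics" unfolding anisotropic_cubics_def by blast
    qed
  qed simp
  finally show ?thesis by simp
qed

end

section \<open>The fourth moment of the number of points of a cubic\<close>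

context cubic_extension
begin

definition cubic_forms :: "('a \<Rightarrow> 'a) set" where
  "cubic_forms = {T. \<exists>\<alpha> \<beta> \<gamma>. \<exists>h\<in>Fq. T = cub \<alpha> \<beta> \<gamma> h}"

lemma card_cubic_forms: "card cubic_forms \<le> q ^ 10"
proof -
  have "cubic_forms = (\<lambda>(\<alpha>, \<beta>, \<gamma>, h). cub \<alpha> \<beta> \<gamma> h) ` (UNIV \<times> UNIV \<times> UNIV \<times> Fq)"
    unfolding cubic_forms_def by force
  also have "card \<dots> \<le> card ((UNIV :: 'a set) \<times> (UNIV :: 'a set) \<times> (UNIV :: 'a set) \<times> Fq)"
    by (rule card_image_le) simp
  also have "\<dots> = q ^ 10"
    by (simp add: card_cartesian_product card_UNIV_eq card_Fq power_add[symmetric])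
      (simp add: power_Suc[symmetric] power_add[symmetric] mult.commute del: power_Suc)
  finally show ?thesis .
qed

lemma cubic_forms_add:
  "T \<in> cubic_forms \<Longrightarrow> T' \<in> cubic_forms \<Longrightarrow> (\<lambda>x. T x + T' x) \<in> cubic_forms"
proof -
  assume "T \<in> cubic_forms" "T' \<in> cubic_forms"
  then obtain a b c d a' b' c' d' where T: "T = cub a b c d" "d \<in> Fq" "T' = cub a' b' c' d'" "d' \<in> Fq"
    unfolding cubic_forms_def by blast
  have "(\<lambda>x. T x + T' x) = cub (a + a') (b + b') (c + c') (d + d')" unfolding T(1,3) by (rule ext) (rule cub_add)
  thus ?thesis unfolding cubic_forms_def using Fq_add[OF T(2,4)] by blast
qed

lemma cubic_forms_smult:
  "T \<in> cubic_forms \<Longrightarrow> e \<in> Fq \<Longrightarrow> (\<lambda>x. e * T x) \<in> cubic_forms"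
proof -
  assume "T \<in> cubic_forms" and e: "e \<in> Fq"
  then obtain a b c d where T: "T = cub a b c d" "d \<in> Fq" unfolding cubic_forms_def by blast
  have "(\<lambda>x. e * T x) = cub (e * a) (e * b) (e * c) (e * d)" unfolding T(1) by (rule ext) (rule cub_smult[OF e])
  thus ?thesis unfolding cubic_forms_def using Fq_mult[OF e T(2)] by blast
qed

lemma cubic_forms_in_Fq: "T \<in> cubic_forms \<Longrightarrow> T x \<in> Fq"
  unfolding cubic_forms_def using cub_in_Fq by blast

text \<open>A product of three linear forms, each one at \<open>a\<close> and zero at one of the
  other points.\<close>

lemma ex_separating_form:
  assumes "a \<noteq> 0" "b = 0 \<or> a / b \<notin> Fq" "c = 0 \<or> a / c \<notin> Fq" "d = 0 \<or> a / d \<notin> Fq"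
  obtains T where "T \<in> cubic_forms" "T a = 1" "T b = 0" "T c = 0" "T d = 0"
proof -
  obtain \<beta>1 where b1: "tr (\<beta>1 * a) = 1" "tr (\<beta>1 * b) = 0" using ex_functional'[OF assms(1,2)] by blast
  obtain \<beta>2 where b2: "tr (\<beta>2 * a) = 1" "tr (\<beta>2 * c) = 0" using ex_functional'[OF assms(1,3)] by blast
  obtain \<beta>3 where b3: "tr (\<beta>3 * a) = 1" "tr (\<beta>3 * d) = 0" using ex_functional'[OF assms(1,4)] by blast
  define T where "T = (\<lambda>x. tr (\<beta>1 * x) * tr (\<beta>2 * x) * tr (\<beta>3 * x))"
  have l: "tr (\<beta> * x) = lin \<beta> (fr \<beta>) (fr (fr \<beta>)) x" for \<beta> x unfolding tr_def lin_def by simp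
  have "T x = tr (1 * lin \<beta>1 (fr \<beta>1) (fr (fr \<beta>1)) x * lin \<beta>2 (fr \<beta>2) (fr (fr \<beta>2)) x * lin \<beta>3 (fr \<beta>3) (fr (fr \<beta>3)) x)" for x
  proof -
    have "tr (T x) = T x" unfolding T_def by (intro tr_of_Fq Fq_mult) auto
    thus ?thesis unfolding l[symmetric] by (simp add: T_def)
  qed
  moreover obtain \<alpha> \<beta> \<gamma> h where "h \<in> Fq" and
    "\<And>x. tr (1 * lin \<beta>1 (fr \<beta>1) (fr (fr \<beta>1)) x * lin \<beta>2 (fr \<beta>2) (fr (fr \<beta>2)) x * lin \<beta>3 (fr \<beta>3) (fr (fr \<beta>3)) x) = cub \<alpha> \<beta> \<gamma> h x"
    using tr_prod_lin_eq_cub by metis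
  ultimately have "T = cub \<alpha> \<beta> \<gamma> h" by (intro ext) simp
  hence "T \<in> cubic_forms" using \<open>h \<in> Fq\<close> unfolding cubic_forms_def by blast
  thus ?thesis using that b1 b2 b3 unfolding T_def by simp
qed

text \<open>\<open>q\<close> times the deviation of the indicator of zero from its mean
  \<open>1 / q\<close> on \<open>Fq\<close>.\<close>

definition centred :: "'a \<Rightarrow> real" where
  "centred u = (if u = 0 then real q - 1 else - 1)"

lemma sum_centred:
  assumes "u \<in> Fq" shows "(\<Sum>t\<in>Fq. centred (u + t)) = 0"
proof -
  have "(\<Sum>t\<in>Fq. centred (u + t)) = (\<Sum>t\<in>Fq. centred t)"
    by (rule sum.reindex_bij_witness[of _ "\<lambda>t. u + t" "\<lambda>t. u + t"]) (use assms Fq_add in auto)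
  also have "\<dots> = centred 0 + (\<Sum>t\<in>Fq - {0}. centred t)" by (rule sum.remove) auto
  also have "(\<Sum>t\<in>Fq - {0}. centred t) = (\<Sum>t\<in>Fq - {0}. - 1)" by (intro sum.cong) (auto simp: centred_def)
  also have "\<dots> = - (real q - 1)" using q_ge by (simp add: card_Fq)
  finally show ?thesis unfolding centred_def by simp
qed

lemma centred_square: "centred u * centred u = (real q - 1) + (real q - 2) * centred u"
  unfolding centred_def by (simp add: algebra_simps)

text \<open>Adding \<open>t * T0\<close>, with \<open>T0\<close> separating \<open>a\<close> from
  the rest, permutes the cubic forms and changes only the value at \<open>a\<close>; averaging over
  \<open>t\<close> gives zero. The point \<open>0\<close> serves as placeholder when fewer than four
  points are involved.\<close>

lemma centred_independent:
  assumes "a \<noteq> 0" "b = 0 \<or> a / b \<notin> Fq" "c = 0 \<or> a / c \<notin> Fq" "d = 0 \<or> a / d \<notin> Fq"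
  shows "(\<Sum>T\<in>cubic_forms. centred (T a) * \<Phi> (T b) (T c) (T d)) = (0::real)"
proof -
  obtain T0 where T0: "T0 \<in> cubic_forms" "T0 a = 1" "T0 b = 0" "T0 c = 0" "T0 d = 0"
    using ex_separating_form[OF assms] by blast
  let ?S = "\<Sum>T\<in>cubic_forms. centred (T a) * \<Phi> (T b) (T c) (T d)"
  have shift: "?S = (\<Sum>T\<in>cubic_forms. centred (T a + t) * \<Phi> (T b) (T c) (T d))" if t: "t \<in> Fq" for t
  proof (rule sum.reindex_bij_witness[of _ "\<lambda>T x. T x + t * T0 x" "\<lambda>T x. T x + t * T0 x"])
    fix T assume T: "T \<in> cubic_forms"
    thus "(\<lambda>x. T x + t * T0 x) \<in> cubic_forms"
      using cubic_forms_add cubic_forms_smult[OF T0(1) t] by blast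
    thus "(\<lambda>x. T x + t * T0 x) \<in> cubic_forms" .
    show "(\<lambda>x. (T x + t * T0 x) + t * T0 x) = T" by (simp add: add.assoc)
    thus "(\<lambda>x. (T x + t * T0 x) + t * T0 x) = T" .
    show "centred ((T a + t * T0 a) + t) * \<Phi> (T b + t * T0 b) (T c + t * T0 c) (T d + t * T0 d)
       = centred (T a) * \<Phi> (T b) (T c) (T d)" using T0 by (simp add: add.assoc)
  qed
  have "(\<Sum>t\<in>Fq. ?S) = (\<Sum>t\<in>Fq. \<Sum>T\<in>cubic_forms. centred (T a + t) * \<Phi> (T b) (T c) (T d))"
    by (intro sum.cong refl shift)
  also have "\<dots> = (\<Sum>T\<in>cubic_forms. (\<Sum>t\<in>Fq. centred (T a + t)) * \<Phi> (T b) (T c) (T d))"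
    by (subst sum.swap) (simp add: sum_distrib_right)
  also have "\<dots> = 0" by (intro sum.neutral ballI) (simp add: sum_centred cubic_forms_in_Fq)
  finally show ?thesis using q_ge by (simp add: card_Fq)
qed

text \<open>Representatives of pairwise distinct points of the projective plane over
  \<open>Fq\<close>.\<close>

definition independent_points :: "'a set \<Rightarrow> bool" where
  "independent_points S \<longleftrightarrow> 0 \<notin> S \<and> (\<forall>a\<in>S. \<forall>b\<in>S. a / b \<in> Fq \<longrightarrow> a = b)"

text \<open>Write \<open>X\<close> for the variable of the new point and \<open>W\<close> for the
  old sum. As \<open>X * X = u + v * X\<close>, all powers of \<open>X\<close> become linear in
  \<open>X\<close>, and terms with \<open>X\<close> sum to zero against \<open>1\<close>,
  \<open>W\<close>, \<open>W^2\<close> and \<open>W^3\<close>. From the fourth power there remain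
  \<open>W^4\<close>, \<open>6 * u * W^2\<close>, for which the second moment is carried along
  exactly, and a constant of at most \<open>q ^ 3\<close>.\<close>

lemma moments:
  assumes "finite S" "independent_points S"
  shows "(\<Sum>T\<in>cubic_forms. (\<Sum>r\<in>S. centred (T r)) ^ 2) = real (card S) * (real q - 1) * real (card cubic_forms)
     \<and> (\<Sum>T\<in>cubic_forms. (\<Sum>r\<in>S. centred (T r)) ^ 4)
       \<le> (3 * real (card S) ^ 2 * (real q - 1) ^ 2 + real (card S) * real q ^ 3) * real (card cubic_forms)"
  using assms
proof (induction S rule: finite_induct)
  case (insert a S)
  have indS: "independent_points S" using insert.prems unfolding independent_points_def by blast
  have a: "a \<noteq> 0" using insert.prems unfolding independent_points_def by blast
  have sep: "b = 0 \<or> a / b \<notin> Fq" if "b \<in> S" for b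
    using insert.prems insert.hyps(2) that unfolding independent_points_def by blast
  have nonz: "b \<noteq> 0" if "b \<in> S" for b using insert.prems that unfolding independent_points_def by blast
  define W where "W = (\<lambda>T. \<Sum>r\<in>S. centred (T r))"
  define X where "X = (\<lambda>T :: 'a \<Rightarrow> 'a. centred (T a))"
  define F where "F = real (card cubic_forms)"
  define u v where "u = real q - 1" and "v = real q - 2"
  have EX: "(\<Sum>T\<in>cubic_forms. X T) = 0"
    using centred_independent[OF a, of 0 0 0 "\<lambda>_ _ _. 1"] unfolding X_def by simp
  have EXW: "(\<Sum>T\<in>cubic_forms. X T * W T) = 0"
  proof -
    have "(\<Sum>T\<in>cubic_forms. X T * W T) = (\<Sum>b\<in>S. \<Sum>T\<in>cubic_forms. X T * centred (T b))"
      unfolding W_def sum_distrib_left by (rule sum.swap)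
    also have "\<dots> = 0" unfolding X_def
      using centred_independent[OF a sep, of _ 0 0 "\<lambda>y _ _. centred y"] by (intro sum.neutral) simp
    finally show ?thesis .
  qed
  have EXW2: "(\<Sum>T\<in>cubic_forms. X T * (W T * W T)) = 0"
  proof -
    have "(\<Sum>T\<in>cubic_forms. X T * (W T * W T))
       = (\<Sum>T\<in>cubic_forms. \<Sum>b\<in>S. \<Sum>c\<in>S. X T * (centred (T b) * centred (T c)))"
      unfolding W_def unfolding sum_product unfolding sum_distrib_left ..
    also have "\<dots> = (\<Sum>b\<in>S. \<Sum>T\<in>cubic_forms. \<Sum>c\<in>S. X T * (centred (T b) * centred (T c)))" by (rule sum.swap)
    also have "\<dots> = (\<Sum>b\<in>S. \<Sum>c\<in>S. \<Sum>T\<in>cubic_forms. X T * (centred (T b) * centred (T c)))"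
      by (intro sum.cong refl sum.swap)
    also have "\<dots> = 0" unfolding X_def
      by (rule sum.neutral, rule ballI, rule sum.neutral, rule ballI,
          rule centred_independent[OF a sep sep, of _ _ 0 "\<lambda>y z _. centred y * centred z"]) auto
    finally show ?thesis .
  qed
  have EXW3: "(\<Sum>T\<in>cubic_forms. X T * (W T * (W T * W T))) = 0"
  proof -
    have "(\<Sum>T\<in>cubic_forms. X T * (W T * (W T * W T)))
       = (\<Sum>T\<in>cubic_forms. \<Sum>b\<in>S. \<Sum>c\<in>S. \<Sum>d\<in>S. X T * (centred (T b) * (centred (T c) * centred (T d))))"
      unfolding W_def unfolding sum_product unfolding sum_distrib_left ..
    also have "\<dots> = (\<Sum>b\<in>S. \<Sum>T\<in>cubic_forms. \<Sum>c\<in>S. \<Sum>d\<in>S. X T * (centred (T b) * (centred (T c) * centred (T d))))" by (rule sum.swap)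
    also have "\<dots> = (\<Sum>b\<in>S. \<Sum>c\<in>S. \<Sum>T\<in>cubic_forms. \<Sum>d\<in>S. X T * (centred (T b) * (centred (T c) * centred (T d))))"
      by (intro sum.cong refl sum.swap)
    also have "\<dots> = (\<Sum>b\<in>S. \<Sum>c\<in>S. \<Sum>d\<in>S. \<Sum>T\<in>cubic_forms. X T * (centred (T b) * (centred (T c) * centred (T d))))"
      by (intro sum.cong refl sum.swap)
    also have "\<dots> = 0" unfolding X_def
      by (rule sum.neutral, rule ballI, rule sum.neutral, rule ballI, rule sum.neutral, rule ballI,
          rule centred_independent[OF a sep sep sep, of _ _ _ "\<lambda>y z w. centred y * (centred z * centred w)"]) auto
    finally show ?thesis .
  qed
  have EW: "(\<Sum>T\<in>cubic_forms. W T) = 0"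
  proof -
    have "(\<Sum>T\<in>cubic_forms. W T) = (\<Sum>b\<in>S. \<Sum>T\<in>cubic_forms. centred (T b))" unfolding W_def by (rule sum.swap)
    also have "\<dots> = 0" using centred_independent[of _ 0 0 0 "\<lambda>_ _ _. 1"] nonz by simp
    finally show ?thesis .
  qed
  have ins: "(\<Sum>r\<in>insert a S. centred (T r)) = X T + W T" for T
    unfolding X_def W_def using insert.hyps by simp
  have cardI: "real (card (insert a S)) = real (card S) + 1" using insert.hyps by simp
  have XX: "X T * X T = u + v * X T" for T unfolding X_def u_def v_def by (rule centred_square)
  have IH2: "(\<Sum>T\<in>cubic_forms. (W T)^2) = real (card S) * u * F"
    and IH4: "(\<Sum>T\<in>cubic_forms. (W T)^4) \<le> (3 * real (card S) ^ 2 * u ^ 2 + real (card S) * real q ^ 3) * F"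
    using insert.IH[OF indS] unfolding W_def u_def F_def by auto
  have "(X T + W T)^2 = (W T)^2 + 2 * (X T * W T) + u + v * X T" for T
    using XX[of T] by (simp add: power2_eq_square algebra_simps)
  hence "(\<Sum>T\<in>cubic_forms. (X T + W T)^2) = (\<Sum>T\<in>cubic_forms. (W T)^2) + u * F"
    by (simp add: sum.distrib sum_distrib_left[symmetric] EX EXW F_def)
  hence M2: "(\<Sum>T\<in>cubic_forms. (X T + W T)^2) = (real (card S) + 1) * u * F"
    unfolding IH2 by (simp add: algebra_simps)
  have "(X T + W T)^4 = (W T)^4 + 4 * (X T * (W T * (W T * W T))) + 6 * u * (W T)^2 + 6 * v * (X T * (W T * W T))
      + 4 * u * v * W T + 4 * (u + v^2) * (X T * W T) + u * (u + v^2) + (2 * u * v + v^3) * X T" for T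
  proof -
    have "(X T + W T)^4 = (W T)^4 + 4 * (X T * (W T * (W T * W T))) + 6 * (X T * X T) * (W T)^2
       + 4 * ((X T * X T) * X T) * W T + (X T * X T) * (X T * X T)"
      by (simp add: power4_eq_xxxx power2_eq_square algebra_simps)
    also have "(X T * X T) * X T = u * X T + v * (X T * X T)" by (subst XX) (simp add: algebra_simps)
    also have "(X T * X T) * (X T * X T) = u * u + 2 * u * v * X T + v * v * (X T * X T)"
      unfolding XX by (simp add: algebra_simps XX)
    finally show ?thesis unfolding XX by (simp add: algebra_simps power2_eq_square power3_eq_cube)
  qed
  hence "(\<Sum>T\<in>cubic_forms. (X T + W T)^4) = (\<Sum>T\<in>cubic_forms. (W T)^4) + 6 * u * (real (card S) * u * F) + u * (u + v^2) * F"
    by (simp add: sum.distrib sum_distrib_left[symmetric] EX EXW EXW2 EXW3 EW IH2 F_def)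
  also have "\<dots> \<le> (3 * real (card S) ^ 2 * u ^ 2 + real (card S) * real q ^ 3) * F
     + 6 * u * (real (card S) * u * F) + real q ^ 3 * F"
  proof -
    have uv: "0 \<le> u" "0 \<le> v" "u \<le> real q" "u + v^2 \<le> real q ^ 2"
      unfolding u_def v_def using q_ge by (auto simp: power2_eq_square algebra_simps)
    have "u * (u + v^2) \<le> real q * real q ^ 2" using uv by (intro mult_mono) auto
    hence "u * (u + v^2) * F \<le> real q ^ 3 * F" unfolding F_def
      by (intro mult_right_mono) (auto simp: power2_eq_square power3_eq_cube)
    thus ?thesis using IH4 by linarith
  qed
  also have "\<dots> \<le> (3 * (real (card S) + 1) ^ 2 * u ^ 2 + (real (card S) + 1) * real q ^ 3) * F"
  proof -
    have "(3 * (real (card S) + 1) ^ 2 * u ^ 2 + (real (card S) + 1) * real q ^ 3) * F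
      = (3 * real (card S) ^ 2 * u ^ 2 + real (card S) * real q ^ 3) * F
     + 6 * u * (real (card S) * u * F) + real q ^ 3 * F + 3 * u ^ 2 * F"
      by (simp add: algebra_simps power2_eq_square)
    moreover have "0 \<le> 3 * u ^ 2 * F" unfolding F_def by simp
    ultimately show ?thesis by linarith
  qed
  finally show ?case using M2 unfolding ins cardI u_def[symmetric] F_def[symmetric] by blast
qed auto

text \<open>A choice from each scaling class; the chosen element depends on the class only. Its size
  comes from \<open>(q - 1) * card R = q ^ 3 - 1\<close>.\<close>

lemma ex_point_set:
  obtains R where "independent_points R" "\<And>a. a \<noteq> 0 \<Longrightarrow> \<exists>r\<in>R. \<exists>c\<in>Fq. c \<noteq> 0 \<and> a = c * r"
    "card R = q\<^sup>2 + q + 1"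
proof -
  define rep where "rep = (\<lambda>a. SOME b. \<exists>c\<in>Fq. c \<noteq> 0 \<and> b = c * a)"
  have rep: "\<exists>c\<in>Fq. c \<noteq> 0 \<and> rep a = c * a" for a
    unfolding rep_def by (rule someI[of _ a]) (rule bexI[of _ 1], auto)
  have rep_eq: "rep (c * a) = rep a" if c: "c \<in> Fq" "c \<noteq> 0" for c a
  proof -
    have "(\<exists>d\<in>Fq. d \<noteq> 0 \<and> b = d * (c * a)) \<longleftrightarrow> (\<exists>d\<in>Fq. d \<noteq> 0 \<and> b = d * a)" for b
    proof
      assume "\<exists>d\<in>Fq. d \<noteq> 0 \<and> b = d * (c * a)"
      then obtain d where "d \<in> Fq" "d \<noteq> 0" "b = d * (c * a)" by blast
      thus "\<exists>d\<in>Fq. d \<noteq> 0 \<and> b = d * a" using c by (intro bexI[of _ "d * c"]) (auto simp: Fq_mult)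
    next
      assume "\<exists>d\<in>Fq. d \<noteq> 0 \<and> b = d * a"
      then obtain d where "d \<in> Fq" "d \<noteq> 0" "b = d * a" by blast
      thus "\<exists>d\<in>Fq. d \<noteq> 0 \<and> b = d * (c * a)" using c
        by (intro bexI[of _ "d * inverse c"]) (auto simp: Fq_mult Fq_inverse)
    qed
    thus ?thesis unfolding rep_def by simp
  qed
  define R where "R = rep ` (UNIV - {0})"
  have ind: "independent_points R" unfolding independent_points_def
  proof (intro conjI ballI impI)
    show "0 \<notin> R"
    proof
      assume "0 \<in> R"
      then obtain a where a: "a \<noteq> 0" "0 = rep a" unfolding R_def by blast
      obtain c where "c \<noteq> 0" "rep a = c * a" using rep[of a] by blast
      thus False using a by (metis mult_eq_0_iff)
    qed
    fix x y assume x: "x \<in> R" and y: "y \<in> R" and q: "x / y \<in> Fq"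
    obtain a b where ab: "x = rep a" "y = rep b" "a \<noteq> 0" "b \<noteq> 0" using x y unfolding R_def by blast
    obtain c d where cd: "c \<in> Fq" "c \<noteq> 0" "x = c * a" "d \<in> Fq" "d \<noteq> 0" "y = d * b" using rep[of a] rep[of b] ab(1,2) by blast
    have "x = (x / y) * y" "x / y \<noteq> 0" using cd ab by auto
    hence "rep x = rep y" using rep_eq[OF q, of y] by simp
    moreover have "rep x = x" "rep y = y"
      using rep_eq[OF cd(1,2), of a] rep_eq[OF cd(4,5), of b] cd(3,6) ab(1,2) by simp_all
    ultimately show "x = y" by simp
  qed
  have cov: "\<exists>r\<in>R. \<exists>c\<in>Fq. c \<noteq> 0 \<and> a = c * r" if a: "a \<noteq> 0" for a
  proof -
    obtain c where c: "c \<in> Fq" "c \<noteq> 0" "rep a = c * a" using rep by blast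
    have "a = inverse c * rep a" unfolding c(3) using c(2) by simp
    moreover have "inverse c \<in> Fq" "inverse c \<noteq> 0" using c Fq_inverse by auto
    moreover have "rep a \<in> R" unfolding R_def using a by blast
    ultimately show ?thesis by blast
  qed
  have R0: "r \<noteq> 0" if "r \<in> R" for r using ind that unfolding independent_points_def by blast
  have "bij_betw (\<lambda>(c, r). c * r) ((Fq - {0}) \<times> R) (UNIV - {0})"
  proof (rule bij_betw_imageI)
    show "inj_on (\<lambda>(c, r). c * r) ((Fq - {0}) \<times> R)"
    proof (rule inj_onI)
      fix p p' assume pp: "p \<in> (Fq - {0}) \<times> R" "p' \<in> (Fq - {0}) \<times> R" "(\<lambda>(c, r). c * r) p = (\<lambda>(c, r). c * r) p'"
      obtain c r c' r' where p: "p = (c, r)" "p' = (c', r')" by (cases p, cases p') blast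
      have cr: "c \<in> Fq" "c \<noteq> 0" "r \<in> R" "c' \<in> Fq" "c' \<noteq> 0" "r' \<in> R" "c * r = c' * r'" using pp unfolding p by auto
      have "r / r' = inverse c * c'" using cr R0 by (simp add: field_simps)
      hence "r = r'" using ind cr Fq_mult Fq_inverse unfolding independent_points_def by metis
      thus "p = p'" using cr R0 unfolding p by auto
    qed
    show "(\<lambda>(c, r). c * r) ` ((Fq - {0}) \<times> R) = UNIV - {0}"
      using cov R0 by (auto simp: image_iff)
  qed
  hence "card ((Fq - {0}) \<times> R) = card (UNIV - {0::'a})" by (rule bij_betw_same_card)
  hence c1: "(q - 1) * card R = q ^ 3 - 1"
    by (simp add: card_cartesian_product card_Fq card_UNIV_eq card_Diff_singleton)
  obtain k where k: "q = Suc k" "k > 0" using q_ge by (cases q) auto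
  have c2: "q ^ 3 - 1 = (q - 1) * (q\<^sup>2 + q + 1)" unfolding k(1) by (simp add: power2_eq_square power3_eq_cube algebra_simps)
  have "(q - 1) * card R = (q - 1) * (q\<^sup>2 + q + 1)" using c1 unfolding c2 .
  moreover have "q - 1 \<noteq> 0" using k by simp
  ultimately have "card R = q\<^sup>2 + q + 1" by (metis mult_left_cancel)
  thus ?thesis using that ind cov by blast
qed

text \<open>Chebyshev with fourth powers: a form without zeros has the deviation \<open>- n\<close>
  where \<open>n = q^2 + q + 1\<close>.\<close>

lemma card_anisotropic_cubics: "card anisotropic_cubics \<le> 4 * q ^ 8"
proof -
  obtain R where R: "independent_points R" "card R = q\<^sup>2 + q + 1" using ex_point_set by blast
  define n where "n = real (card R)"
  have sub: "anisotropic_cubics \<subseteq> cubic_forms" unfolding anisotropic_cubics_def cubic_forms_def by blast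
  have "(\<Sum>r\<in>R. centred (T r)) = - n" if "T \<in> anisotropic_cubics" for T
  proof -
    have "centred (T r) = - 1" if "r \<in> R" for r
    proof -
      have "r \<noteq> 0" using that R(1) unfolding independent_points_def by blast
      hence "T r \<noteq> 0" using \<open>T \<in> anisotropic_cubics\<close> unfolding anisotropic_cubics_def anisotropic_def by blast
      thus ?thesis unfolding centred_def by simp
    qed
    thus ?thesis unfolding n_def by simp
  qed
  hence "real (card anisotropic_cubics) * n ^ 4 = (\<Sum>T\<in>anisotropic_cubics. (\<Sum>r\<in>R. centred (T r)) ^ 4)" by simp
  also have "\<dots> \<le> (\<Sum>T\<in>cubic_forms. (\<Sum>r\<in>R. centred (T r)) ^ 4)"
    by (intro sum_mono2 sub) auto
  also have "\<dots> \<le> (3 * n ^ 2 * (real q - 1) ^ 2 + n * real q ^ 3) * real (card cubic_forms)"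
    using moments[OF _ R(1)] unfolding n_def by auto
  also have "\<dots> \<le> (4 * n ^ 2 * real q ^ 2) * real q ^ 10"
  proof (intro mult_mono)
    have "(real q - 1) ^ 2 \<le> real q ^ 2" using q_ge by (intro power_mono) auto
    hence "3 * n ^ 2 * (real q - 1) ^ 2 \<le> 3 * n ^ 2 * real q ^ 2" by (intro mult_left_mono) auto
    \<comment> \<open>The linear term is absorbed into the quadratic one, turning the constant 3
      into 4.\<close>
    moreover have "real q \<le> n" unfolding n_def R(2) by simp
    hence "(n * real q ^ 2) * real q \<le> (n * real q ^ 2) * n" unfolding n_def by (intro mult_left_mono) auto
    hence "n * real q ^ 3 \<le> n ^ 2 * real q ^ 2" by (simp add: power2_eq_square power3_eq_cube mult_ac)
    ultimately show "3 * n ^ 2 * (real q - 1) ^ 2 + n * real q ^ 3 \<le> 4 * n ^ 2 * real q ^ 2" by linarith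
    show "real (card cubic_forms) \<le> real q ^ 10" using card_cubic_forms by (metis of_nat_le_iff of_nat_power)
  qed auto
  finally have "(real (card anisotropic_cubics) * n ^ 2) * n ^ 2 \<le> (4 * real q ^ 12) * n ^ 2"
    by (simp add: algebra_simps flip: power_add)
  moreover have "card R > 0" using R(2) by simp
  hence "n > 0" unfolding n_def by simp
  ultimately have "real (card anisotropic_cubics) * n ^ 2 \<le> 4 * real q ^ 12" by simp
  moreover have "real q ^ 4 \<le> n ^ 2"
  proof -
    have "(real q ^ 2) ^ 2 \<le> n ^ 2" unfolding n_def R(2) by (intro power_mono) auto
    thus ?thesis by (simp flip: power_mult)
  qed
  hence "real (card anisotropic_cubics) * real q ^ 4 \<le> real (card anisotropic_cubics) * n ^ 2"
    by (intro mult_left_mono) auto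
  moreover have "4 * real q ^ 12 = (4 * real q ^ 8) * real q ^ 4" by (simp flip: power_add)
  ultimately have "real (card anisotropic_cubics) * real q ^ 4 \<le> (4 * real q ^ 8) * real q ^ 4" by linarith
  hence "real (card anisotropic_cubics) \<le> 4 * real q ^ 8" using q_pos by simp
  also have "\<dots> = real (4 * q ^ 8)" by simp
  finally show ?thesis by (simp only: of_nat_le_iff)
qed

text \<open>A singular map kills one of the \<open>q^2 + q + 1\<close> points, and then its first
  coefficient is determined by the other two.\<close>

lemma card_noninvertible: "card {g. \<not> inj (lin3 g)} \<le> 2 * q ^ 8"
proof -
  obtain R where R: "independent_points R" "\<And>a. a \<noteq> 0 \<Longrightarrow> \<exists>r\<in>R. \<exists>c\<in>Fq. c \<noteq> 0 \<and> a = c * r" "card R = q\<^sup>2 + q + 1"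
    using ex_point_set by blast
  have "{g. \<not> inj (lin3 g)} \<subseteq> (\<Union>r\<in>R. {g. lin3 g r = 0})"
  proof
    fix g assume "g \<in> {g. \<not> inj (lin3 g)}"
    then obtain a where a: "a \<noteq> 0" "lin3 g a = 0" unfolding lin_inj_iff by blast
    then obtain r c where "r \<in> R" "c \<in> Fq" "c \<noteq> 0" "a = c * r" using R(2) by blast
    thus "g \<in> (\<Union>r\<in>R. {g. lin3 g r = 0})" using a lin_scale by auto
  qed
  hence "card {g. \<not> inj (lin3 g)} \<le> card (\<Union>r\<in>R. {g. lin3 g r = 0})" by (intro card_mono) auto
  also have "\<dots> \<le> (\<Sum>r\<in>R. card {g. lin3 g r = 0})" by (rule card_UN_le) simp
  also have "\<dots> \<le> (\<Sum>r\<in>R. q ^ 6)"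
  proof (rule sum_mono)
    fix r assume "r \<in> R"
    hence r: "r \<noteq> 0" using R(1) unfolding independent_points_def by blast
    have "inj_on snd {g. lin3 g r = 0}"
    proof (rule inj_onI)
      fix g g' assume gg: "g \<in> {g. lin3 g r = 0}" "g' \<in> {g. lin3 g r = 0}" "snd g = snd g'"
      hence "lin3 g r + lin3 g' r = 0" by simp
      hence "(fst g + fst g') * r = 0" unfolding lin_def gg(3) by (simp add: algebra_simps)
      thus "g = g'" using r gg(3) by (simp add: add_eq_0_char2 prod_eq_iff)
    qed
    hence "card {g. lin3 g r = 0} \<le> CARD('a \<times> 'a)" by (intro card_inj_on_le[of snd]) auto
    thus "card {g. lin3 g r = 0} \<le> q ^ 6" by (simp add: card_UNIV_eq flip: power_add)
  qed
  also have "\<dots> = (q\<^sup>2 + q + 1) * q ^ 6" using R(3) by simp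
  also have "\<dots> \<le> (2 * q\<^sup>2) * q ^ 6"
  proof (rule mult_right_mono)
    have "2 * q \<le> q * q" using q_ge by (intro mult_right_mono) auto
    thus "q\<^sup>2 + q + 1 \<le> 2 * q\<^sup>2" unfolding power2_eq_square using q_pos by linarith
  qed simp
  also have "\<dots> = 2 * q ^ 8" by (simp flip: power_add)
  finally show ?thesis .
qed

theorem anisotropic_cubic_is_norm_form:
  assumes "anisotropic (cub \<alpha> \<beta> \<gamma> h)" "h \<in> Fq" "h \<noteq> 0"
  shows "is_norm_form (cub \<alpha> \<beta> \<gamma> h)"
proof (rule ccontr)
  assume no: "\<not> is_norm_form (cub \<alpha> \<beta> \<gamma> h)"
  have "q ^ 9 = CARD('a \<times> 'a \<times> 'a)" by (simp add: card_UNIV_eq flip: power_add)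
  also have "\<dots> = card ({g. inj (lin3 g)} \<union> {g. \<not> inj (lin3 g)})"
    by (rule arg_cong[where f=card]) blast
  also have "\<dots> = card {g. inj (lin3 g)} + card {g. \<not> inj (lin3 g)}"
    by (rule card_Un_disjoint) auto
  also have "\<dots> \<le> 27 * card anisotropic_cubics + 2 * q ^ 8"
    using card_invertible_le[OF assms no] card_noninvertible by (rule add_mono)
  \<comment> \<open>\<open>27 * 4 + 2 = 110\<close>.\<close>
  also have "\<dots> \<le> 110 * q ^ 8" using card_anisotropic_cubics by simp
  also have "\<dots> < q * q ^ 8" using q_ge by (intro mult_strict_right_mono) auto
  also have "\<dots> = q ^ 9" by (simp flip: power_Suc)
  finally show False by simp
qed

end

section \<open>Reduction to a quadratic map\<close>

context cubic_extension
begin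

definition quad :: "'a \<Rightarrow> 'a \<Rightarrow> 'a \<Rightarrow> 'a" where
  "quad A B u = fr u * (A * u + fr u + B * fr (fr u))"

lemma quad_0 [simp]: "quad A B 0 = 0" unfolding quad_def by simp

lemma quad_scale: "c \<in> Fq \<Longrightarrow> quad A B (c * u) = c\<^sup>2 * quad A B u"
  unfolding quad_def Fq_iff by (simp add: power2_eq_square algebra_simps)

lemma poly_f_poly: "poly (f_poly q A B) x = x ^ (q\<^sup>2 - q + 1) + A * fr (fr x) + B * x"
  unfolding f_poly_def fr_fr by (simp add: poly_monom)

lemma poly_f_poly_eq_quad:
  assumes x: "x \<noteq> 0" shows "poly (f_poly q A B) x = quad A B (inverse x) * nm x"
proof -
  have "q \<le> q\<^sup>2" by (simp add: power2_eq_square)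
  hence "x ^ (q\<^sup>2 - q + 1) * x ^ q = x ^ (q\<^sup>2 + 1)" by (simp flip: power_add)
  hence "x ^ (q\<^sup>2 - q + 1) * fr x = x * fr (fr x)" unfolding fr_fr by (simp add: fr_def)
  hence "x ^ (q\<^sup>2 - q + 1) = x * fr (fr x) / fr x" using x by (simp add: field_simps)
  moreover have "quad A B (inverse x) * nm x = x * fr (fr x) / fr x + A * fr (fr x) + B * x"
    unfolding quad_def nm_def using x by (simp add: field_simps)
  ultimately show ?thesis unfolding poly_f_poly by simp
qed

lemma poly_f_poly_0: "poly (f_poly q A B) (0::'a) = 0"
  unfolding poly_f_poly by simp

text \<open>Under scaling by \<open>Fq\<close>, \<open>f\<close> has degree one and
  \<open>quad\<close> degree two. From a collision of \<open>quad\<close>, scaling each point by the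
  norm of the other balances the norm factors, and comparing norms shows them equal. From a
  collision of \<open>f\<close>, the square root of the quotient of the norms lies in
  \<open>Fq\<close> and does the same.\<close>

lemma permutation_iff_inj_quad: "permutation_polynomial (f_poly q A B) \<longleftrightarrow> inj (quad A B)"
proof -
  let ?f = "poly (f_poly q A B)" and ?g = "quad A B"
  have "bij ?f \<longleftrightarrow> inj ?f" unfolding bij_def using finite_UNIV_inj_surj[OF finite] by blast
  also have "inj ?f \<longleftrightarrow> inj ?g"
  proof
    assume f: "inj ?f"
    show "inj ?g"
    proof (rule injI)
      have g0: "u = 0" if "?g u = 0" for u
      proof (rule ccontr)
        assume u: "u \<noteq> 0"
        hence "?f (inverse u) = ?f 0" using poly_f_poly_eq_quad[of "inverse u" A B] that by (simp add: poly_f_poly_0)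
        thus False using f u by (metis injD inverse_nonzero_iff_nonzero)
      qed
      fix u u' assume eq: "?g u = ?g u'"
      show "u = u'"
      proof (cases "u = 0 \<or> u' = 0")
        case True
        thus ?thesis using g0 eq by (metis quad_0)
      next
        case False
        define x x' where "x = inverse u" and "x' = inverse u'"
        have x: "x \<noteq> 0" "x' \<noteq> 0" "inverse x = u" "inverse x' = u'" using False unfolding x_def x'_def by auto
        have h: "?f (c * y) = c * ?f y" if "c \<in> Fq" "c \<noteq> 0" "y \<noteq> 0" for c y
        proof -
          have "?f (c * y) = quad A B (inverse c * inverse y) * nm (c * y)"
            using poly_f_poly_eq_quad[of "c * y"] that by simp
          also have "\<dots> = ((inverse c)\<^sup>2 * (c * c * c)) * (quad A B (inverse y) * nm y)"
            using that by (simp add: quad_scale Fq_inverse nm_mult) (simp add: nm_def Fq_fr)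
          also have "(inverse c)\<^sup>2 * (c * c * c) = c" using that by (simp add: power2_eq_square field_simps)
          finally show ?thesis using poly_f_poly_eq_quad[OF that(3)] by simp
        qed
        have "?f (nm x' * x) = nm x' * (?g u * nm x)"
          using x h[of "nm x'" x] poly_f_poly_eq_quad[OF x(1)] by simp
        also have "\<dots> = nm x * (?g u' * nm x')" unfolding eq by (simp add: mult_ac)
        also have "\<dots> = ?f (nm x * x')" using x h[of "nm x" x'] poly_f_poly_eq_quad[OF x(2)] by simp
        finally have e: "nm x' * x = nm x * x'" using f by (metis injD)
        hence "nm (nm x' * x) = nm (nm x * x')" by simp
        hence "nm x' * nm x' * nm x' * nm x = nm x * nm x * nm x * nm x'"
          by (simp add: nm_mult) (simp add: nm_def[of "nm x"] nm_def[of "nm x'"] Fq_fr)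
        hence "(nm x')\<^sup>2 * (nm x' * nm x) = (nm x)\<^sup>2 * (nm x' * nm x)" by (simp add: power2_eq_square mult_ac)
        hence "nm x' = nm x" using x by simp
        hence "x = x'" using e x by simp
        thus ?thesis using x by metis
      qed
    qed
  next
    assume g: "inj ?g"
    show "inj ?f"
    proof (rule injI)
      have f0: "x = 0" if "?f x = 0" for x
      proof (rule ccontr)
        assume x: "x \<noteq> 0"
        hence "?g (inverse x) = ?g 0" using poly_f_poly_eq_quad[OF x, of A B] that by simp
        thus False using g x by (metis injD inverse_nonzero_iff_nonzero)
      qed
      fix x x' assume eq: "?f x = ?f x'"
      show "x = x'"
      proof (cases "x = 0 \<or> x' = 0")
        case True
        thus ?thesis using f0 eq by (metis poly_f_poly_0)
      next
        case False
        hence x: "x \<noteq> 0" "x' \<noteq> 0" by auto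
        obtain c where c: "c\<^sup>2 = nm x / nm x'" using ex_sqrt by blast
        have cF: "c \<in> Fq" using c Fq_sqrt by (metis Fq_inverse Fq_mult divide_inverse nm_in_Fq)
        have "?g (inverse x) * nm x = ?g (inverse x') * nm x'"
          using eq unfolding poly_f_poly_eq_quad[OF x(1)] poly_f_poly_eq_quad[OF x(2)] .
        hence "nm x / nm x' * ?g (inverse x) = ?g (inverse x')"
          using x by (metis mult.commute nm_eq_0_iff nonzero_mult_div_cancel_right times_divide_eq_left)
        hence "?g (c * inverse x) = ?g (inverse x')" unfolding quad_scale[OF cF] c .
        hence "c * inverse x = inverse x'" using g by (metis injD)
        hence e: "x = c * x'" using x by (simp add: field_simps)
        hence "c\<^sup>2 * nm x' = c * c * c * nm x'" using c x cF by (simp add: nm_mult) (simp add: nm_def Fq_fr)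
        hence "c = 1" using e x by (simp add: power2_eq_square)
        thus ?thesis using e by simp
      qed
    qed
  qed
  finally show ?thesis unfolding permutation_polynomial_def .
qed

text \<open>Substituting \<open>c * u\<close> only multiplies \<open>quad\<close> by a nonzero
  constant. The new coefficients keep their norms and the product \<open>fr A * B\<close>.\<close>

lemma inj_quad_twist:
  assumes c: "c \<noteq> 0"
  shows "inj (quad A B) \<longleftrightarrow> inj (quad (A * c / fr c) (B * fr (fr c) / fr c))"
proof -
  have e: "quad A B (c * u) = (fr c)\<^sup>2 * quad (A * c / fr c) (B * fr (fr c) / fr c) u" for u
    unfolding quad_def using c by (simp add: field_simps power2_eq_square)
  have c': "(fr c)\<^sup>2 \<noteq> 0" using c by simp
  show ?thesis
  proof
    assume i: "inj (quad A B)"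
    show "inj (quad (A * c / fr c) (B * fr (fr c) / fr c))"
    proof (rule injI)
      fix u v assume "quad (A * c / fr c) (B * fr (fr c) / fr c) u = quad (A * c / fr c) (B * fr (fr c) / fr c) v"
      hence "quad A B (c * u) = quad A B (c * v)" unfolding e by simp
      thus "u = v" using i c by (metis injD mult_left_cancel)
    qed
  next
    assume i: "inj (quad (A * c / fr c) (B * fr (fr c) / fr c))"
    show "inj (quad A B)"
    proof (rule injI)
      fix u v assume "quad A B u = quad A B v"
      hence "quad A B (c * (u / c)) = quad A B (c * (v / c))" using c by simp
      hence "u / c = v / c" unfolding e using i c' by (metis injD mult_left_cancel)
      thus "u = v" using c by simp
    qed
  qed
qed

text \<open>The Lagrange resolvent for the generator \<open>fr \<circ> fr\<close>; it is a nonzero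
  linearized polynomial as its first coefficient is one.\<close>

lemma hilbert90:
  assumes t: "nm t = 1" obtains c where "c \<noteq> 0" "fr (fr c) = t * c"
proof -
  have t0: "t \<noteq> 0" using t by auto
  define U V W where "U = (1::'a)" and "V = inverse (t * fr (fr t))" and "W = inverse t"
  obtain z where z: "lin U V W z \<noteq> 0" using lin_eq_0_imp[of U V W] unfolding U_def by auto
  have "fr t * t * fr (fr t) = 1" using t by (simp add: nm_def mult_ac)
  hence t': "t * (fr t * fr (fr t)) = 1" and i: "inverse (fr t) = t * fr (fr t)" by (metis mult.left_commute mult.assoc, metis inverse_unique mult.assoc)
  have "fr (fr (lin U V W z)) = t * lin U V W z"
    unfolding U_def V_def W_def lin_def using t0 by (simp add: i t' field_simps)
  thus ?thesis using that z by blast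
qed

text \<open>For \<open>A\<close> in \<open>Fq\<close>, the trace of \<open>g v\<close> is the square
  of \<open>tr v\<close>, so colliding points have equal traces; their difference turns out to lie
  in \<open>Fq\<close> with trace zero, and such an element is zero.\<close>

lemma inj_quad_equal_coeffs:
  assumes A: "A \<noteq> 0"
  shows "inj (quad A A) \<longleftrightarrow> A \<in> Fq \<and> A \<noteq> 1"
proof -
  define g where "g = (\<lambda>v. (A + 1) * v\<^sup>2 + A * v * tr v)"
  have e: "quad A A u = g (fr u)" for u
    unfolding quad_def g_def tr_def by (simp add: algebra_simps power2_eq_square)
  have ig: "inj (quad A A) \<longleftrightarrow> inj g"
  proof
    assume "inj (quad A A)"
    thus "inj g" unfolding inj_def e by (metis fr3)
  next
    assume "inj g"
    thus "inj (quad A A)" unfolding inj_def e by (metis fr3)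
  qed
  show ?thesis unfolding ig
  proof
    assume inj: "inj g"
    have A1: "A \<noteq> 1"
    proof
      assume "A = 1"
      hence g: "g v = v * tr v" for v unfolding g_def by simp
      obtain a where "a \<notin> Fq" using ex_not_Fq by blast
      hence "1 / a \<notin> Fq" "a \<noteq> 0" using Fq_inverse by (metis divide_inverse inverse_inverse_eq mult_1, metis Fq_0)
      then obtain \<beta> where \<beta>: "tr (\<beta> * 1) = 1" "tr (\<beta> * a) = 0" using ex_functional[of 1 a] by auto
      have "\<beta> \<noteq> 0" using \<beta> by auto
      hence "g (\<beta> * a) = g 0" "\<beta> * a \<noteq> 0" using \<beta> \<open>a \<noteq> 0\<close> unfolding g by auto
      thus False using inj by (metis injD)
    qed
    have "A \<in> Fq"
    proof (rule ccontr)
      assume AF: "A \<notin> Fq"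
      \<comment> \<open>If \<open>tr u = tr w = 1\<close>, then \<open>g (u + w) = g u\<close> means
        \<open>u = E * w^2\<close> for this \<open>E\<close>. With \<open>r^2 = E\<close> the two
        trace conditions read \<open>tr w = 1\<close> and \<open>tr (r * w) = 1\<close>, solvable
        because \<open>r\<close> is not in \<open>Fq\<close>.\<close>
      define E where "E = (A + 1) / A"
      obtain r where r: "r\<^sup>2 = E" using ex_sqrt by blast
      have E0: "E \<noteq> 0" unfolding E_def using A A1 by (simp add: add_eq_0_char2)
      hence r0: "r \<noteq> 0" using r by auto
      have "E \<notin> Fq"
      proof
        assume E: "E \<in> Fq"
        have "E + 1 = inverse A" unfolding E_def using A by (simp add: field_simps)
        hence "A = inverse (E + 1)" by simp
        thus False using AF E Fq_add Fq_inverse by (metis Fq_1)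
      qed
      hence rF: "r \<notin> Fq" using r Fq_sqrt by metis
      hence "1 / r \<notin> Fq" using Fq_inverse by (metis divide_inverse inverse_inverse_eq mult_1)
      then obtain p where p: "tr (p * 1) = 1" "tr (p * r) = 0" using ex_functional[of 1 r] r0 by auto
      obtain s where s: "tr (s * r) = 1" "tr (s * 1) = 0" using ex_functional[of r 1] r0 rF by auto
      define w where "w = p + s"
      have w: "tr w = 1" unfolding w_def tr_add using p s by simp
      have "tr (E * w\<^sup>2) = (tr (r * w))\<^sup>2"
        unfolding r[symmetric] tr_def by (simp add: power2_eq_square algebra_simps)
      also have "tr (r * w) = 1" using p s unfolding w_def by (simp add: tr_add ring_distribs mult.commute)
      finally have tu: "tr (E * w\<^sup>2) = 1" by simp
      define u where "u = E * w\<^sup>2"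
      have "g (u + w) = (A + 1) * (u\<^sup>2 + w\<^sup>2)"
        unfolding g_def tr_add tu[folded u_def] w by (simp add: power2_sum)
      also have "(A + 1) * w\<^sup>2 = A * u" unfolding u_def E_def using A by simp
      hence "(A + 1) * (u\<^sup>2 + w\<^sup>2) = g u" unfolding g_def tu[folded u_def] by (simp add: ring_distribs)
      finally have "u + w = u" using inj by (metis injD)
      hence "w = 0" by simp
      thus False using w by simp
    qed
    thus "A \<in> Fq \<and> A \<noteq> 1" using A1 by simp
  next
    assume AF: "A \<in> Fq \<and> A \<noteq> 1"
    show "inj g"
    proof (rule injI)
      have trg: "tr (g v) = (tr v)\<^sup>2" for v
      proof -
        have "tr (g v) = (A + 1) * tr (v\<^sup>2) + A * tr v * tr v"
          unfolding g_def tr_add using AF by (subst (1 2) mult.assoc) (simp add: tr_scale Fq_add mult.commute[of v])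
        also have "tr (v\<^sup>2) = (tr v)\<^sup>2" unfolding tr_def by (simp add: power2_eq_square algebra_simps)
        finally show ?thesis by (simp add: power2_eq_square algebra_simps)
      qed
      fix u v assume eq: "g u = g v"
      hence t: "tr u = tr v" using trg by (metis square_eq_iff)
      define d where "d = u + v"
      have v: "v = u + d" unfolding d_def by simp
      have td: "tr d = 0" unfolding d_def tr_add t by simp
      have "g u + g v = 0" using eq by simp
      hence "d * ((A + 1) * d + A * tr v) = 0"
        unfolding g_def t unfolding d_def by (simp add: power2_eq_square algebra_simps)
      hence "d = 0 \<or> (A + 1) * d = A * tr v" by (metis add_eq_0_char2 mult_eq_0_iff)
      hence "d \<in> Fq"
      proof
        assume "(A + 1) * d = A * tr v"
        hence "d = A * tr v * inverse (A + 1)" using AF by (simp add: field_simps add_eq_0_char2)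
        thus ?thesis using AF by (auto intro!: Fq_mult Fq_inverse Fq_add)
      qed simp
      hence "d = 0" using td tr_of_Fq by simp
      thus "u = v" unfolding d_def by (simp add: add_eq_0_char2)
    qed
  qed
qed

text \<open>Hilbert 90 for \<open>A / B\<close> provides a twist making both coefficients equal to
  \<open>A'\<close>. If \<open>fr A' * A'\<close> is fixed by \<open>fr\<close>, then
  \<open>fr (fr A') = A'\<close>, so \<open>A'\<close> is in \<open>Fq\<close>.\<close>

lemma inj_quad_equal_norms:
  assumes AB: "A \<noteq> 0" "B \<noteq> 0" "nm A = nm B"
  shows "inj (quad A B) \<longleftrightarrow> fr A * B \<in> Fq - {0, 1}"
proof -
  have "nm (A / B) = 1" using AB by (simp add: nm_divide)
  then obtain c where c: "c \<noteq> 0" "fr (fr c) = A / B * c" by (rule hilbert90)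
  define A' where "A' = A * c / fr c"
  have B': "B * fr (fr c) / fr c = A'" unfolding A'_def c(2) using AB by simp
  have A'0: "A' \<noteq> 0" unfolding A'_def using AB c by simp
  have "fr A' * A' = (fr A * fr c / fr (fr c)) * (B * fr (fr c) / fr c)" unfolding B' by (simp add: A'_def)
  hence w: "fr A' * A' = fr A * B" using c by simp
  have "inj (quad A B) \<longleftrightarrow> inj (quad A' A')"
    using inj_quad_twist[OF c(1), of A B] unfolding B' A'_def[symmetric] .
  hence "inj (quad A B) \<longleftrightarrow> A' \<in> Fq \<and> A' \<noteq> 1" unfolding inj_quad_equal_coeffs[OF A'0] .
  also have "\<dots> \<longleftrightarrow> fr A' * A' \<in> Fq - {0, 1}"
  proof
    assume *: "A' \<in> Fq \<and> A' \<noteq> 1"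
    hence "fr A' * A' = A'\<^sup>2" by (simp add: Fq_fr power2_eq_square)
    moreover have "A'\<^sup>2 \<noteq> 1" using * square_eq_iff[of A' 1] by simp
    ultimately show "fr A' * A' \<in> Fq - {0, 1}" using * A'0 Fq_sqrt by simp
  next
    assume *: "fr A' * A' \<in> Fq - {0, 1}"
    hence "fr (fr A' * A') = fr A' * A'" using Fq_iff by blast
    hence "fr (fr A') = A'" using A'0 by (simp add: mult.commute)
    hence "fr A' = A'" by (metis fr3)
    moreover from this have "A' \<noteq> 1" using * by auto
    ultimately show "A' \<in> Fq \<and> A' \<noteq> 1" by (simp add: Fq_iff)
  qed
  finally show ?thesis unfolding w .
qed

end

section \<open>The collision cubic\<close>

context cubic_extension
begin

definition bil :: "'a \<Rightarrow> 'a \<Rightarrow> 'a \<Rightarrow> 'a \<Rightarrow> 'a" where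
  "bil A B a u = u * (A * fr a) + fr u * (A * a + B * fr (fr a)) + fr (fr u) * (B * fr a)"

text \<open>The map \<open>bil A B a\<close> kills \<open>a\<close>, so the 2x2 minors of its matrix
  are products of a conjugate of \<open>a\<close> and a conjugate of a vector orthogonal to its
  image. This is that vector, linear in \<open>a\<close>.\<close>

definition normal_vec :: "'a \<Rightarrow> 'a \<Rightarrow> 'a \<Rightarrow> 'a" where
  "normal_vec A B = lin (fr B * fr (fr B)) (fr A * fr (fr B)) (fr A * fr (fr A))"

text \<open>The pairing of \<open>normal_vec A B a\<close>, linear in \<open>a\<close>, with
  \<open>quad A B a\<close>, quadratic in \<open>a\<close>, written out in the normal form
  \<open>cub\<close>.\<close>

definition collision_cubic :: "'a \<Rightarrow> 'a \<Rightarrow> 'a \<Rightarrow> 'a" where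
  "collision_cubic A B = cub (A * fr B) (A * fr A) (B * fr B) (nm A + nm B)"

lemma quad_add: "quad A B (u + a) = quad A B u + quad A B a + bil A B a u"
  unfolding quad_def bil_def by (simp add: algebra_simps)

lemma bil_add: "bil A B a (u + v) = bil A B a u + bil A B a v"
  unfolding bil_def by (simp add: algebra_simps)

lemma tr_normal_vec_bil: "tr (normal_vec A B a * bil A B a u) = 0"
  unfolding normal_vec_def bil_def lin_def tr_def by (simp add: algebra_simps)

lemma tr_normal_vec_quad: "tr (normal_vec A B a * quad A B a) = collision_cubic A B a"
  unfolding normal_vec_def quad_def collision_cubic_def cub_def nm_def lin_def tr_def by (simp add: algebra_simps)

text \<open>The determinant of \<open>normal_vec A B\<close> is the square of
  \<open>nm A + nm B\<close>.\<close>

lemma normal_vec_nonzero: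
  assumes "nm A \<noteq> nm B" "a \<noteq> 0" shows "normal_vec A B a \<noteq> 0"
proof -
  have "dickson (fr B * fr (fr B)) (fr A * fr (fr B)) (fr A * fr (fr A)) = (nm A + nm B)\<^sup>2"
    unfolding dickson_def nm_def by (simp add: power2_eq_square algebra_simps)
  moreover have "nm A + nm B \<noteq> 0" using assms by (simp add: add_eq_0_char2)
  ultimately have "inj (normal_vec A B)" unfolding normal_vec_def dickson_nonzero_iff[symmetric] by simp
  thus ?thesis using assms unfolding normal_vec_def lin_inj_iff by blast
qed

text \<open>Cramer's rule: \<open>a * normal_vec A B a\<close> is a 2x2 minor of the matrix of \<open>bil A B a\<close> in the coordinates
  \<open>u, fr u, fr (fr u)\<close>.\<close>
lemma bil_kernel:
  assumes "bil A B a u = 0" "a \<noteq> 0" "normal_vec A B a \<noteq> 0"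
  shows "u / a \<in> Fq"
proof -
  have "a * fr u + fr a * u = 0"
  proof -
    have "(a * fr u + fr a * u) * a * normal_vec A B a
      = a * (fr (bil A B a u) * (fr (fr A) * a) + fr (fr (bil A B a u)) * (fr A * fr a + fr B * a))"
      unfolding bil_def normal_vec_def lin_def by (simp add: algebra_simps)
    thus ?thesis using assms by simp
  qed
  hence "a * fr u = fr a * u" by (simp add: add_eq_0_char2)
  hence "fr (u / a) = u / a" using assms(2) by (simp add: field_simps)
  thus ?thesis by (simp add: Fq_iff)
qed

lemma card_trace_kernel: "card {w. tr w = 0} \<le> q\<^sup>2"
proof -
  let ?p = "monom 1 (q\<^sup>2) + monom 1 q + monom (1::'a) 1"
  have lt: "1 < q" "q < q\<^sup>2" using q_ge by (auto simp: power2_eq_square)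
  hence "coeff ?p (q\<^sup>2) = 1" by simp
  hence "?p \<noteq> 0" by (metis coeff_0 zero_neq_one)
  hence "card {w. poly ?p w = 0} \<le> degree ?p" by (rule card_roots_le)
  also have "\<dots> \<le> q\<^sup>2" using lt by (intro degree_add_le) (auto simp: degree_monom_eq)
  also have "{w. poly ?p w = 0} = {w. tr w = 0}"
    unfolding tr_def fr_fr by (simp add: fr_def poly_monom add_ac)
  finally show ?thesis .
qed

text \<open>The kernel lies in \<open>Fq * a\<close>, so the image has at least \<open>q^2\<close>
  elements; it sits inside a trace hyperplane with at most that many.\<close>

lemma ex_bil_eq:
  assumes nv: "normal_vec A B a \<noteq> 0" and a: "a \<noteq> 0" and w: "tr (normal_vec A B a * w) = 0"
  shows "\<exists>u. bil A B a u = w"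
proof -
  let ?b = "bil A B a" and ?\<theta> = "normal_vec A B a"
  have "CARD('a) \<le> q * card (range ?b)"
  proof (rule card_le_fibers)
    fix y
    show "card {x \<in> UNIV. ?b x = y} \<le> q"
    proof (cases "{x \<in> UNIV. ?b x = y} = {}")
      case True show ?thesis unfolding True by simp
    next
      case False
      then obtain x0 where x0: "?b x0 = y" by blast
      have "{x \<in> UNIV. ?b x = y} \<subseteq> (\<lambda>c. x0 + c * a) ` Fq"
      proof
        fix x assume "x \<in> {x \<in> UNIV. ?b x = y}"
        hence "?b (x0 + x) = 0" unfolding bil_add using x0 by simp
        hence "(x0 + x) / a \<in> Fq" using bil_kernel a nv by blast
        moreover have "x = x0 + (x0 + x) / a * a" using a by simp
        ultimately show "x \<in> (\<lambda>c. x0 + c * a) ` Fq" by blast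
      qed
      hence "card {x \<in> UNIV. ?b x = y} \<le> card ((\<lambda>c. x0 + c * a) ` Fq)" by (intro card_mono) auto
      also have "\<dots> \<le> q" using card_image_le[of Fq "\<lambda>c. x0 + c * a"] card_Fq by simp
      finally show ?thesis .
    qed
  qed simp
  hence "q * q\<^sup>2 \<le> q * card (range ?b)" using card_UNIV_eq by (simp add: power3_eq_cube power2_eq_square)
  hence ge: "q\<^sup>2 \<le> card (range ?b)" using q_pos by simp
  have "card {w. tr (?\<theta> * w) = 0} \<le> card {w. tr w = 0}"
    by (rule card_inj_on_le[of "\<lambda>w. ?\<theta> * w"]) (use nv in \<open>auto intro: inj_onI\<close>)
  hence "card {w. tr (?\<theta> * w) = 0} \<le> card (range ?b)" using card_trace_kernel ge by linarith
  moreover have "range ?b \<subseteq> {w. tr (?\<theta> * w) = 0}" using tr_normal_vec_bil by auto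
  ultimately have "range ?b = {w. tr (?\<theta> * w) = 0}" by (intro card_seteq) auto
  thus ?thesis using w by (metis (mono_tags, lifting) imageE mem_Collect_eq)
qed

text \<open>For a fixed difference \<open>a\<close>, a collision
  \<open>quad A B (u + a) = quad A B u\<close> is the linear equation
  \<open>bil A B a u = quad A B a\<close>, solvable iff the right side is orthogonal to
  \<open>normal_vec A B a\<close>.\<close>

lemma inj_quad_iff_anisotropic:
  assumes ne: "nm A \<noteq> nm B"
  shows "inj (quad A B) \<longleftrightarrow> anisotropic (collision_cubic A B)"
proof
  assume inj: "inj (quad A B)"
  show "anisotropic (collision_cubic A B)" unfolding anisotropic_def
  proof (intro allI impI notI)
    fix a assume a: "a \<noteq> 0" and "collision_cubic A B a = 0"
    hence "tr (normal_vec A B a * quad A B a) = 0" unfolding tr_normal_vec_quad by simp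
    then obtain u where "bil A B a u = quad A B a" using ex_bil_eq normal_vec_nonzero[OF ne a] a by blast
    hence "quad A B (u + a) = quad A B u" unfolding quad_add by (simp add: add.assoc)
    hence "u + a = u" using inj by (metis injD)
    thus False using a by simp
  qed
next
  assume an: "anisotropic (collision_cubic A B)"
  show "inj (quad A B)"
  proof (rule injI)
    fix u v assume eq: "quad A B u = quad A B v"
    define a where "a = u + v"
    have "v = u + a" unfolding a_def by simp
    hence "quad A B u = quad A B u + (quad A B a + bil A B a u)" using eq quad_add[of A B u a] by (simp add: add.assoc)
    hence "quad A B a + bil A B a u = 0" by (metis add_cancel_right_right)
    hence "quad A B a = bil A B a u" by (simp add: add_eq_0_char2)
    hence "collision_cubic A B a = 0" unfolding tr_normal_vec_quad[symmetric] using tr_normal_vec_bil by simp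
    hence "a = 0" using an unfolding anisotropic_def by blast
    thus "u = v" unfolding a_def by (simp add: add_eq_0_char2)
  qed
qed

section \<open>Comparison of the collision cubic with norm forms\<close>

lemma nm_lin_eq_cub:
  "nm (lin \<alpha> \<beta> \<gamma> x) = cub (\<alpha> * fr \<gamma> * fr (fr \<beta>))
     (\<alpha> * fr \<gamma> * fr (fr \<gamma>) + \<alpha> * fr \<alpha> * fr (fr \<beta>) + \<beta> * fr \<gamma> * fr (fr \<beta>))
     (\<alpha> * fr \<gamma> * fr (fr \<alpha>) + \<alpha> * fr \<beta> * fr (fr \<beta>) + \<gamma> * fr \<gamma> * fr (fr \<beta>))
     (nm \<alpha> + nm \<beta> + nm \<gamma> + tr (\<alpha> * fr \<beta> * fr (fr \<gamma>))) x"
  unfolding nm_def cub_def tr_def lin_def by (simp add: algebra_simps)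

text \<open>The explicit factor has the shape found in \<open>norm_form_coeffs_normalized\<close>,
  with \<open>fr B\<close> for \<alpha> and \<beta> equal to \<alpha> times its conjugate. It is
  invertible because \<open>nm A * nm B = 1\<close> with distinct norms excludes
  \<open>nm B = 1\<close>.\<close>

lemma anisotropic_collision_cubic:
  assumes AB: "fr A * B = 1" and ne: "nm A \<noteq> nm B"
  shows "anisotropic (collision_cubic A B)"
proof -
  have B0: "B \<noteq> 0" using AB by auto
  have "fr (fr (fr A * B)) = 1" by (simp only: AB fr_1)
  hence "A * fr (fr B) = 1" by simp
  note e = this AB
  have "nm (fr A * B) = 1" using AB by simp
  hence N: "nm B * nm A = 1" by (simp add: nm_mult mult.commute)
  have "nm B \<noteq> 1" using N ne by auto
  hence "nm B + 1 \<noteq> 0" by (simp add: add_eq_0_char2)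
  moreover have "dickson (fr B) (fr B * fr (fr B)) 1 = (nm B + 1)\<^sup>2"
    unfolding dickson_def nm_def by (simp add: power2_eq_square algebra_simps)
  ultimately have inj: "inj (lin (fr B) (fr B * fr (fr B)) 1)" unfolding dickson_nonzero_iff[symmetric] by simp
  have "nm B * collision_cubic A B x = nm (lin (fr B) (fr B * fr (fr B)) 1 x)" for x
  proof -
    have c: "nm B * (A * fr B) = B * fr B * fr B" "nm B * (A * fr A) = fr B"
      "nm B * (nm A + nm B) = 1 + nm B * nm B"
    proof -
      have "nm B * (A * fr B) = (A * fr (fr B)) * (B * fr B * fr B)" unfolding nm_def by (simp only: mult_ac)
      thus "nm B * (A * fr B) = B * fr B * fr B" by (simp only: e mult_1)
      have "nm B * (A * fr A) = (A * fr (fr B)) * (fr A * B) * fr B" unfolding nm_def by (simp only: mult_ac)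
      thus "nm B * (A * fr A) = fr B" by (simp only: e mult_1)
      show "nm B * (nm A + nm B) = 1 + nm B * nm B" by (simp add: ring_distribs N)
    qed
    have "nm B * collision_cubic A B x = cub (B * fr B * fr B) (fr B) (nm B * (B * fr B)) (1 + nm B * nm B) x"
      unfolding collision_cubic_def cub_smult[OF nm_in_Fq] c ..
    also have "\<dots> = nm (lin (fr B) (fr B * fr (fr B)) 1 x)"
      unfolding nm_lin_eq_cub by (rule arg_cong2[where f="\<lambda>u v. u v x"])
        (simp_all add: nm_def tr_def algebra_simps)
    finally show ?thesis .
  qed
  moreover have "lin (fr B) (fr B * fr (fr B)) 1 x \<noteq> 0" if "x \<noteq> 0" for x using inj that lin_inj_iff by blast
  ultimately show ?thesis unfolding anisotropic_def by (metis mult_zero_right nm_eq_0_iff)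
qed

text \<open>The first two equations express \<open>A * fr A\<close> and \<open>B\<close> through
  \<alpha>, \<open>A\<close> and \<open>c\<close>; the last one gives \<open>c = nm A\<close>. Norms
  in \<open>A * fr A = c * \<alpha>\<close> then yield \<open>nm A * nm \<alpha> = 1\<close>, and
  the left side is also \<open>fr A * B\<close>.\<close>

lemma norm_form_coeffs_normalized:
  assumes e1: "c * (\<alpha> * fr (fr \<beta>)) = A * fr B"
    and e2: "c * (\<alpha> + \<alpha> * fr \<alpha> * fr (fr \<beta>) + \<beta> * fr (fr \<beta>)) = A * fr A"
    and e4: "c * (nm \<alpha> + nm \<beta> + 1 + tr (\<alpha> * fr \<beta>)) = nm A + nm B"
    and ne: "nm A + nm B \<noteq> 0" and A: "A \<noteq> 0" and c: "c \<in> Fq" and \<beta>: "\<beta> = \<alpha> * fr \<alpha>"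
  shows "fr A * B = 1"
proof -
  have b2: "fr (fr \<beta>) = fr (fr \<alpha>) * \<alpha>" unfolding \<beta> by simp
  have AA: "A * fr A = c * \<alpha>"
    using e2 unfolding b2 \<beta> by (simp add: algebra_simps)
  have "A * fr B = (c * \<alpha>) * (\<alpha> * fr (fr \<alpha>))" using e1 unfolding b2 by (simp add: mult_ac)
  hence "A * fr B = A * (fr A * (\<alpha> * fr (fr \<alpha>)))" unfolding AA[symmetric] by (simp add: mult_ac)
  hence "fr B = fr A * (\<alpha> * fr (fr \<alpha>))" using A by simp
  hence "fr (fr (fr B)) = fr (fr (fr A * (\<alpha> * fr (fr \<alpha>))))" by simp
  hence B: "B = A * (fr (fr \<alpha>) * fr \<alpha>)" by simp
  define \<nu> where "\<nu> = nm \<alpha>"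
  have nB: "nm B = nm A * (\<nu> * \<nu>)" unfolding B nm_mult \<nu>_def by simp
  have k: "nm \<alpha> + nm \<beta> + 1 + tr (\<alpha> * fr \<beta>) = 1 + \<nu> * \<nu>"
    unfolding \<beta> nm_mult \<nu>_def by (simp add: nm_def tr_def algebra_simps)
  have "c * (1 + \<nu> * \<nu>) = nm A * (1 + \<nu> * \<nu>)" using e4 unfolding k nB by (simp add: ring_distribs)
  moreover have "1 + \<nu> * \<nu> \<noteq> 0"
  proof
    assume z: "1 + \<nu> * \<nu> = 0"
    have "nm A + nm B = nm A * (1 + \<nu> * \<nu>)" unfolding nB by (simp add: ring_distribs)
    thus False using ne z by simp
  qed
  ultimately have cA: "c = nm A" by simp
  have w: "fr A * B = c * \<nu>"
  proof -
    have "fr A * B = (A * fr A) * (fr (fr \<alpha>) * fr \<alpha>)" unfolding B by (simp only: mult_ac)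
    thus ?thesis unfolding AA \<nu>_def nm_def by (simp add: mult_ac)
  qed
  have "nm (A * fr A) = nm c * \<nu>" unfolding AA nm_mult \<nu>_def ..
  hence "nm A * nm A = nm A * nm A * (nm A * \<nu>)"
    using c unfolding nm_mult cA by (simp add: nm_def[of "nm A"] Fq_fr mult_ac)
  hence "nm A * \<nu> = 1" using A by simp
  thus ?thesis using w cA by simp
qed

text \<open>Dividing the linear factor by its last coefficient, nonzero by the first equation, moves
  \<open>nm \<gamma>\<close> into the constant.\<close>

lemma norm_form_coeffs:
  assumes e1: "c * (\<alpha> * fr \<gamma> * fr (fr \<beta>)) = A * fr B"
    and e2: "c * (\<alpha> * fr \<gamma> * fr (fr \<gamma>) + \<alpha> * fr \<alpha> * fr (fr \<beta>) + \<beta> * fr \<gamma> * fr (fr \<beta>)) = A * fr A"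
    and e4: "c * (nm \<alpha> + nm \<beta> + nm \<gamma> + tr (\<alpha> * fr \<beta> * fr (fr \<gamma>))) = nm A + nm B"
    and ne: "nm A + nm B \<noteq> 0" and A: "A \<noteq> 0" and B: "B \<noteq> 0" and c: "c \<in> Fq" and cr: "\<alpha> * fr \<alpha> + \<beta> * fr \<gamma> = 0"
  shows "fr A * B = 1"
proof -
  have g0: "\<gamma> \<noteq> 0" using e1 A B by auto
  define a b where "a = \<alpha> / \<gamma>" and "b = \<beta> / \<gamma>"
  have ab: "\<alpha> = a * \<gamma>" "\<beta> = b * \<gamma>" unfolding a_def b_def using g0 by auto
  show ?thesis
  proof (rule norm_form_coeffs_normalized[of "c * nm \<gamma>" a b, OF _ _ _ ne A])
    show "c * nm \<gamma> * (a * fr (fr b)) = A * fr B"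
      unfolding e1[symmetric] ab nm_def by (simp add: mult_ac)
    show "c * nm \<gamma> * (a + a * fr a * fr (fr b) + b * fr (fr b)) = A * fr A"
      unfolding e2[symmetric] ab nm_def by (simp add: algebra_simps)
    show "c * nm \<gamma> * (nm a + nm b + 1 + tr (a * fr b)) = nm A + nm B"
      unfolding e4[symmetric] ab nm_mult tr_def nm_def[of \<gamma>] by (simp add: algebra_simps)
    show "c * nm \<gamma> \<in> Fq" using c by (intro Fq_mult) auto
    have "\<gamma> * fr \<gamma> * (a * fr a + b) = 0" using cr unfolding ab by (simp add: algebra_simps)
    hence "a * fr a + b = 0" using g0 by simp
    thus "b = a * fr a" by (metis add_eq_0_char2)
  qed
qed

text \<open>The restriction of the collision cubic to \<open>z = 0\<close> has a double root, so two of the three conjugate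
  linear factors of a norm form agree there; conjugating the factor, these are the first two.\<close>
lemma norm_form_collision_cubic:
  assumes nf: "is_norm_form (collision_cubic A B)" and ne: "nm A \<noteq> nm B" and A: "A \<noteq> 0" and B: "B \<noteq> 0"
  shows "fr A * B = 1"
proof -
  obtain c \<alpha> \<beta> \<gamma> where inj: "inj (lin \<alpha> \<beta> \<gamma>)" and eq: "\<And>x. collision_cubic A B x = c * nm (lin \<alpha> \<beta> \<gamma> x)"
    using nf unfolding is_norm_form_def by blast
  have ne': "nm A + nm B \<noteq> 0" using ne by (simp add: add_eq_0_char2)
  have cF: "c \<in> Fq"
  proof -
    have nz: "nm (lin \<alpha> \<beta> \<gamma> 1) \<noteq> 0" using inj lin_inj_iff by auto
    have "collision_cubic A B 1 \<in> Fq" unfolding collision_cubic_def by (intro cub_in_Fq Fq_add) auto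
    hence "collision_cubic A B 1 * inverse (nm (lin \<alpha> \<beta> \<gamma> 1)) \<in> Fq" by (intro Fq_mult Fq_inverse) auto
    thus ?thesis unfolding eq using nz by (simp add: mult.assoc)
  qed
  note coeffs = cub_eq_imp[OF eq[unfolded collision_cubic_def nm_lin_eq_cub cub_smult[OF cF]]]
  have e1: "c * (\<alpha> * fr \<gamma> * fr (fr \<beta>)) = A * fr B"
    and e2: "c * (\<alpha> * fr \<gamma> * fr (fr \<gamma>) + \<alpha> * fr \<alpha> * fr (fr \<beta>) + \<beta> * fr \<gamma> * fr (fr \<beta>)) = A * fr A"
    and e3: "c * (\<alpha> * fr \<gamma> * fr (fr \<alpha>) + \<alpha> * fr \<beta> * fr (fr \<beta>) + \<gamma> * fr \<gamma> * fr (fr \<beta>)) = B * fr B"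
    and e4: "c * (nm \<alpha> + nm \<beta> + nm \<gamma> + tr (\<alpha> * fr \<beta> * fr (fr \<gamma>))) = nm A + nm B"
    using coeffs by auto
  have c0: "c \<noteq> 0" using e4 ne' by auto
  have frc: "fr c = c" using cF by (rule Fq_fr)
  \<comment> \<open>On \<open>z = 0\<close> the three factors on the left are the determinants of
    pairs of conjugate linear factors. Their product is, up to \<open>c * c\<close>, the expression
    \<open>a * d + b * c\<close> in the four coefficients of the binary cubic, the square root of
    its discriminant in characteristic two.\<close>
  have "c * c * ((\<alpha> * fr \<alpha> + \<beta> * fr \<gamma>) * (fr \<gamma> * fr (fr \<gamma>) + fr \<alpha> * fr (fr \<beta>)) * (fr (fr \<gamma>) * \<alpha> + fr (fr \<beta>) * \<beta>))
    = (c * (\<alpha> * fr \<gamma> * fr (fr \<beta>))) * fr (c * (\<alpha> * fr \<gamma> * fr (fr \<beta>)))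
     + (c * (\<alpha> * fr \<gamma> * fr (fr \<gamma>) + \<alpha> * fr \<alpha> * fr (fr \<beta>) + \<beta> * fr \<gamma> * fr (fr \<beta>)))
       * fr (c * (\<alpha> * fr \<gamma> * fr (fr \<alpha>) + \<alpha> * fr \<beta> * fr (fr \<beta>) + \<gamma> * fr \<gamma> * fr (fr \<beta>)))"
    by (simp add: frc algebra_simps)
  also have "\<dots> = 0" unfolding e1 e2 e3 by (simp add: algebra_simps)
  finally consider "\<alpha> * fr \<alpha> + \<beta> * fr \<gamma> = 0" | "fr \<gamma> * fr (fr \<gamma>) + fr \<alpha> * fr (fr \<beta>) = 0"
    | "fr (fr \<gamma>) * \<alpha> + fr (fr \<beta>) * \<beta> = 0" using c0 by auto
  thus ?thesis
  proof cases
    case 1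
    show ?thesis by (rule norm_form_coeffs[OF e1 e2 e4 ne' A B cF 1])
  next
    case 2
    show ?thesis
    \<comment> \<open>The instantiation order is \<open>c\<close>, \<alpha>, \<gamma>, \<beta>: this
      is the conjugate factor with coefficients \<open>fr \<gamma>\<close>,
      \<open>fr \<alpha>\<close>, \<open>fr \<beta>\<close>, whose norm is the same.\<close>
    proof (rule norm_form_coeffs[of c "fr \<gamma>" "fr \<beta>" "fr \<alpha>", OF _ _ _ ne' A B cF])
    qed (use e1 e2 e4 2 in \<open>simp_all add: nm_def tr_def algebra_simps\<close>)
  next
    case 3
    show ?thesis
    proof (rule norm_form_coeffs[of c "fr (fr \<beta>)" "fr (fr \<alpha>)" "fr (fr \<gamma>)", OF _ _ _ ne' A B cF])
    qed (use e1 e2 e4 3 in \<open>simp_all add: nm_def tr_def algebra_simps\<close>)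
  qed
qed

lemma inj_quad_distinct_norms:
  assumes "A \<noteq> 0" "B \<noteq> 0" and ne: "nm A \<noteq> nm B"
  shows "inj (quad A B) \<longleftrightarrow> fr A * B = 1"
proof
  assume "inj (quad A B)"
  hence "anisotropic (collision_cubic A B)" using inj_quad_iff_anisotropic[OF ne] by blast
  hence "is_norm_form (collision_cubic A B)" unfolding collision_cubic_def
    using ne by (intro anisotropic_cubic_is_norm_form) (auto simp: add_eq_0_char2 intro: Fq_add)
  thus "fr A * B = 1" using norm_form_collision_cubic assms by blast
next
  assume "fr A * B = 1"
  thus "inj (quad A B)" using anisotropic_collision_cubic ne inj_quad_iff_anisotropic by blast
qed

text \<open>If \<open>fr A * B = 1\<close>, the norms are inverse to each other; so they agree
  exactly when \<open>nm B = 1\<close>, squaring being injective. This separates the two conditions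
  along the case split on norms.\<close>

theorem permutation_polynomial_iff:
  assumes A: "A \<noteq> 0" and B: "B \<noteq> 0"
  shows "permutation_polynomial (f_poly q A B) \<longleftrightarrow>
    (nm A = nm B \<and> fr A * B \<in> Fq - {0, 1}) \<or> (fr A * B = 1 \<and> nm B \<noteq> 1)"
proof (cases "nm A = nm B")
  case True
  have "nm B = 1" if "fr A * B = 1"
  proof -
    have "nm (fr A * B) = 1" using that by simp
    hence "(nm B)\<^sup>2 = 1\<^sup>2" using True by (simp add: nm_mult power2_eq_square)
    thus ?thesis unfolding square_eq_iff .
  qed
  thus ?thesis unfolding permutation_iff_inj_quad using inj_quad_equal_norms[OF A B True] True by blast
next
  case False
  have "nm B \<noteq> 1" if "fr A * B = 1"
  proof
    assume 1: "nm B = 1"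
    have "nm (fr A * B) = 1" using that by simp
    hence "nm A = 1" using 1 by (simp add: nm_mult)
    thus False using 1 False by simp
  qed
  thus ?thesis unfolding permutation_iff_inj_quad using inj_quad_distinct_norms[OF A B False] False by blast
qed

end

theorem mainTheorem1:
  fixes m q :: nat
    and Fq :: "'a::finite_field set"
    and A B :: 'a
  assumes "m \<ge> 19"
    and "q = 2 ^ m"
    and "CARD('a) = q ^ 3"
    and "is_subfield Fq"
    and "card Fq = q"
    and "A \<noteq> 0"
    and "B \<noteq> 0"
  shows "permutation_polynomial (f_poly q A B) \<longleftrightarrow>
           (A ^ (1 + q + q^2) = B ^ (1 + q + q^2) \<and> A ^ q * B \<in> Fq - {0, 1})
         \<or> (A ^ q * B = 1 \<and> B ^ (1 + q + q^2) \<noteq> 1)"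
proof -
  interpret cubic_extension m q Fq
    using assms by unfold_locales
  show ?thesis
    using permutation_polynomial_iff[OF assms(6,7)] unfolding nm_eq_power fr_def .
qed

end
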